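(* Let $u$ be a harmonic function in the open upper half-plane $\mathbb{H}$ which is of temperate growth at infinity. Assume that (1)' $\lim_{y\to0+}u(\cdot+iy)=0$ in $\mathcal{D}'(\mathbb{R})$; and (2) there is an admissible function of angles $(E,\eta)$ such that $\displaystyle\lim_{t\to+\infty}u(te^{i\theta})/t^{\eta(\theta)}=0$ for every $\theta\in E$. Then $u(z)=0$ for all $z\in\mathbb{H}$.
   Context: $\mathbb{H}=\{z\in\mathbb{C}:\operatorname{Im} z>0\}$ is the open upper half-plane; $\mathbb{Z}^+=\{1,2,3,\dots\}$. Harmonic functions are complex-valued $C^2$ functions annihilated by the usual Laplacian. A function $u$ in $\mathbb{H}$ is of temperate growth at infinity if there are positive constants $C,R,N$ such that $|u(z)|\leq C\,(|z|^2/\operatorname{Im} z)^N$ for all $z\in\mathbb{H}$ with $|z|>R$. $\lim_{y\to0+}u(\cdot+iy)=0$ in $\mathcal{D}'(\mathbb{R})$ means that $\lim_{y\to0+}\int_{-\infty}^\infty u(x+iy)\psi(x)\,dx=0$ for every $\psi\in C_0^\infty(\mathbb{R})$ (smooth compactly supported test functions). An admissible function of angles is a pair $(E,\eta)$ with $E\subset(0,\pi)$ a set and $\eta:E\to\mathbb{Z}^+$ a function such that for every $k\in\mathbb{Z}^+$ there exists $\theta\in E$ with $\sin(k\theta)\neq0$ and $k\geq\eta(\theta)$. *)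

theory Defs
  imports "HOL-Analysis.Analysis"
begin

definition partial_deriv ::
    "'a::euclidean_space \<Rightarrow> ('a \<Rightarrow> 'b::real_normed_vector) \<Rightarrow> 'a \<Rightarrow> 'b"
  where "partial_deriv v f z = vector_derivative (\<lambda>t. f (z + t *\<^sub>R v)) (at 0)"

(* Meant for open S: all iterated partial derivatives in the coordinate directions up to order k
   exist and are continuous on S. The coordinate directions are 1 and \<i> on complex,
   and just 1 on real. *)
primrec Ck_on ::
    "nat \<Rightarrow> ('a::euclidean_space \<Rightarrow> 'b::real_normed_vector) \<Rightarrow> 'a set \<Rightarrow> bool"
  where
    "Ck_on 0 f S \<longleftrightarrow> continuous_on S f"
  | "Ck_on (Suc k) f S \<longleftrightarrow> continuous_on S f \<and>
       (\<forall>v\<in>Basis. (\<forall>z\<in>S. (\<lambda>t. f (z + t *\<^sub>R v)) differentiable (at (0::real)))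
                 \<and> Ck_on k (partial_deriv v f) S)"

definition laplacian :: "('a::euclidean_space \<Rightarrow> 'b::real_normed_vector) \<Rightarrow> 'a \<Rightarrow> 'b"
  where "laplacian f z = (\<Sum>v\<in>Basis. partial_deriv v (partial_deriv v f) z)"

definition harmonic_on :: "(complex \<Rightarrow> complex) \<Rightarrow> complex set \<Rightarrow> bool"
  where "harmonic_on u S \<longleftrightarrow> Ck_on 2 u S \<and> (\<forall>z\<in>S. laplacian u z = 0)"

definition upper_half_plane :: "complex set"
  where "upper_half_plane = {z. Im z > 0}"

definition temperate_at_infinity :: "(complex \<Rightarrow> complex) \<Rightarrow> bool"
  where "temperate_at_infinity u \<longleftrightarrow>
    (\<exists>C>0. \<exists>R>0. \<exists>N>0. \<forall>z\<in>upper_half_plane. norm z > R \<longrightarrow>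
       norm (u z) \<le> C * ((norm z)\<^sup>2 / Im z) powr N)"

definition test_function :: "(real \<Rightarrow> complex) \<Rightarrow> bool"
  where "test_function \<psi> \<longleftrightarrow> (\<forall>k. Ck_on k \<psi> UNIV) \<and> compact (closure {x. \<psi> x \<noteq> 0})"

definition distributional_boundary_value_zero :: "(complex \<Rightarrow> complex) \<Rightarrow> bool"
  where "distributional_boundary_value_zero u \<longleftrightarrow>
    (\<forall>\<psi>. test_function \<psi> \<longrightarrow>
       ((\<lambda>y. \<integral>x. u (Complex x y) * \<psi> x \<partial>lborel) \<longlongrightarrow> 0) (at_right 0))"

(* Only the values of \<eta> on E matter. *)
definition admissible_angles :: "real set \<Rightarrow> (real \<Rightarrow> nat) \<Rightarrow> bool"
  where "admissible_angles E \<eta> \<longleftrightarrow>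
    E \<subseteq> {0<..<pi} \<and> (\<forall>\<theta>\<in>E. \<eta> \<theta> \<ge> 1) \<and>
    (\<forall>k\<ge>1. \<exists>\<theta>\<in>E. sin (real k * \<theta>) \<noteq> 0 \<and> k \<ge> \<eta> \<theta>)"

end

theory Submission
  imports Defs "HOL-Complex_Analysis.Complex_Analysis"
begin

text \<open>
  Real and imaginary part of \<open>u\<close> are treated separately, each being the real part of a holomorphic function
  \<open>F\<close> on the half-plane. Mollify \<open>F\<close> horizontally with a bump function \<open>\<phi>\<close>. The boundary condition and a
  gliding hump argument show that the mollification of \<open>Re F\<close> and of its horizontal derivatives are bounded near
  the real axis, so the mollified function extends continuously to the real line with vanishing real part, and by
  Schwarz reflection to an entire function. Temperate growth forces the latter to be a polynomial, of a degree
  bounded independently of \<open>\<phi>\<close>. Hence a fixed derivative of \<open>F\<close> is killed by every mollification, so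
  \<open>F\<close> is itself a polynomial, with imaginary coefficients \<open>\<i> * c\<^sub>k\<close>, and
  \<open>Re (F (t * cis \<theta>)) = - (\<Sum>k. c\<^sub>k * sin (k * \<theta>) * t ^ k)\<close>. The growth condition on the ray at angle
  \<open>\<theta>\<close> gives \<open>c\<^sub>k * sin (k * \<theta>) = 0\<close> for \<open>k \<ge> \<eta> \<theta>\<close>, and admissibility yields \<open>c\<^sub>k = 0\<close>
  for all \<open>k \<ge> 1\<close>.
\<close>

section \<open>Bump functions\<close>

text \<open>Schwarz reflection needs a continuous extension to the real axis, and a distributional
  limit provides none for \<open>F\<close> itself. Convolution in the real direction supplies it
  without leaving the holomorphic functions: it commutes with complex differentiation, and every
  derivative can be moved onto the bump, so derivatives of a mollification are again pairings of
  \<open>F\<close> with translates of a test function. One test function at a time, the boundary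
  condition yields only pointwise limits; local uniformity in the translation is a uniform
  boundedness principle, obtained here by constructing a test function that would violate the
  condition. No approximation argument leads back to \<open>F\<close>: a continuous function
  annihilated by all bumps is zero. The order of the derivative must therefore be fixed before the
  bump varies.\<close>

text \<open>The sequence \<open>D\<close> carries a smooth function \<open>D 0\<close> together with all its derivatives \<open>D n\<close>.\<close>

definition smooth_bump :: "(nat \<Rightarrow> real \<Rightarrow> real) \<Rightarrow> bool" where
  "smooth_bump D \<longleftrightarrow> (\<forall>n x. (D n has_real_derivative D (Suc n) x) (at x)) \<and>
     (\<forall>n x. 1 \<le> \<bar>x\<bar> \<longrightarrow> D n x = 0)"

text \<open>The \<open>n\<close>-th derivative of \<open>exp (- 1 / (1 - x\<^sup>2))\<close> on \<open>(-1, 1)\<close> is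
  \<open>bump_poly n x / (1 - x\<^sup>2) ^ (2 * n) * exp (- 1 / (1 - x\<^sup>2))\<close>; the recursion is the quotient rule.\<close>

primrec bump_poly :: "nat \<Rightarrow> real poly" where
  "bump_poly 0 = 1"
| "bump_poly (Suc n) = pderiv (bump_poly n) * [:1, 0, -1:]\<^sup>2 +
     bump_poly n * (smult (of_nat (4 * n)) ([:0, 1:] * [:1, 0, -1:]) - [:0, 2:])"

definition std_bump :: "nat \<Rightarrow> real \<Rightarrow> real" where
  "std_bump n x = (if \<bar>x\<bar> < 1
     then poly (bump_poly n) x * inverse (1 - x\<^sup>2) ^ (2 * n) * exp (- inverse (1 - x\<^sup>2)) else 0)"

lemma power_over_fact_le_exp:
  fixes x :: real
  assumes "0 \<le> x"
  shows "x ^ k / fact k \<le> exp x"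
proof -
  have "(\<lambda>n. x ^ n / fact n) sums exp x"
    using exp_converges[of x] by (simp add: field_simps)
  then have "(\<Sum>n\<in>{k}. x ^ n / fact n) \<le> exp x"
    using assms sum_le_suminf[of "\<lambda>n. x ^ n / fact n" "{k}"] by (auto simp: sums_iff)
  then show ?thesis by simp
qed

text \<open>With \<open>w = 1 - x\<^sup>2\<close>, \<open>exp (- 1 / w)\<close> beats every power of
  \<open>1 / w\<close>. Second-order vanishing at \<open>\<bar>x\<bar> = 1\<close> is what makes the
  difference quotients there tend to 0.\<close>

lemma std_bump_quadratic_bound:
  obtains C where "\<And>x. \<bar>std_bump n x\<bar> \<le> C * (1 - x\<^sup>2)\<^sup>2"
proof -
  have "compact (poly (bump_poly n) ` {-1..1})"
    by (intro compact_continuous_image continuous_intros) auto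
  then obtain B where B: "\<And>x. \<bar>x\<bar> \<le> 1 \<Longrightarrow> \<bar>poly (bump_poly n) x\<bar> \<le> B"
    by (force simp: bounded_iff dest!: compact_imp_bounded)
  have B0: "0 \<le> B" using B[of 0] by linarith
  have "\<bar>std_bump n x\<bar> \<le> (B * fact (2 * n + 2)) * (1 - x\<^sup>2)\<^sup>2" for x
  proof (cases "\<bar>x\<bar> < 1")
    case True
    define w where "w = 1 - x\<^sup>2"
    have w: "w > 0" using True by (simp add: w_def abs_square_less_1)
    \<comment> \<open>The exponent exceeds the pole order \<open>2 * n\<close> by two, which leaves
      the factor \<open>w\<^sup>2\<close>.\<close>
    have "inverse w ^ (2 * n + 2) / fact (2 * n + 2) \<le> exp (inverse w)"
      using w by (intro power_over_fact_le_exp) simp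
    then have "inverse w ^ (2 * n + 2) \<le> fact (2 * n + 2) * exp (inverse w)"
      by (simp only: pos_divide_le_eq[OF fact_gt_zero] mult.commute)
    then have "inverse w ^ (2 * n + 2) * exp (- inverse w) \<le>
        fact (2 * n + 2) * exp (inverse w) * exp (- inverse w)"
      by (intro mult_right_mono) auto
    then have "inverse w ^ (2 * n + 2) * exp (- inverse w) \<le> fact (2 * n + 2)"
      by (simp only: mult.assoc mult_exp_exp) simp
    then have "w\<^sup>2 * (inverse w ^ (2 * n + 2) * exp (- inverse w)) \<le> w\<^sup>2 * fact (2 * n + 2)"
      by (intro mult_left_mono) auto
    moreover have "w\<^sup>2 * (inverse w ^ (2 * n + 2) * exp (- inverse w)) =
        (w * inverse w)\<^sup>2 * (inverse w ^ (2 * n) * exp (- inverse w))"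
      by (simp only: power_add power_mult_distrib mult_ac)
    ultimately have *: "inverse w ^ (2 * n) * exp (- inverse w) \<le> w\<^sup>2 * fact (2 * n + 2)"
      using w by (metis mult_1 power_one right_inverse less_irrefl)
    have "\<bar>std_bump n x\<bar> = \<bar>poly (bump_poly n) x\<bar> * (inverse w ^ (2 * n) * exp (- inverse w))"
      using True w by (simp add: std_bump_def abs_mult flip: w_def)
    also have "\<dots> \<le> B * (w\<^sup>2 * fact (2 * n + 2))"
      using True B0 w by (intro mult_mono * B) auto
    finally show ?thesis by (simp add: w_def algebra_simps)
  qed (use B0 in \<open>simp add: std_bump_def\<close>)
  then show thesis using that by blast
qed

lemma std_bump_deriv_inside:
  assumes "\<bar>x\<bar> < 1"
  shows "(std_bump n has_real_derivative std_bump (Suc n) x) (at x)"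
proof -
  define w where "w = 1 - x\<^sup>2"
  have w: "w > 0" using assms by (simp add: w_def abs_square_less_1)
  let ?f = "\<lambda>x. poly (bump_poly n) x * inverse (1 - x\<^sup>2) ^ (2 * n) * exp (- inverse (1 - x\<^sup>2))"
  have winv: "((\<lambda>x. inverse (1 - x\<^sup>2)) has_real_derivative 2 * x * (inverse w)\<^sup>2) (at x)"
    using w by (auto intro!: derivative_eq_intros simp: w_def power2_eq_square field_simps)
  let ?p = "poly (bump_poly n) x" and ?p' = "poly (pderiv (bump_poly n)) x"
  let ?i = "inverse w" and ?e = "exp (- inverse w)"
  have "(?f has_real_derivative
      (?p' * ?i ^ (2 * n) + (real (2 * n) * (2 * x * ?i\<^sup>2) * ?i ^ (2 * n - 1)) * ?p) * ?e +
      ?e * (- (2 * x * ?i\<^sup>2)) * (?p * ?i ^ (2 * n))) (at x)"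
    unfolding w_def
    by (rule derivative_eq_intros winv[unfolded w_def] refl | simp)+
  then have D: "(?f has_real_derivative
      (?p' * ?i ^ (2 * n) + (real (2 * n) * (2 * x * ?i\<^sup>2) * ?i ^ (2 * n - 1)) * ?p) * ?e +
      ?e * (- (2 * x * ?i\<^sup>2)) * (?p * ?i ^ (2 * n))) (at x)" .
  \<comment> \<open>This covers \<open>n = 0\<close> as well: the exponent is truncated, but the
    factor \<open>real (2 * n)\<close> vanishes.\<close>
  have "real (2 * n) * ?i ^ (2 * n - 1) * ?i = real (2 * n) * ?i ^ (2 * n)"
    by (cases n) auto
  then have e1: "real (2 * n) * (2 * x * ?i\<^sup>2) * ?i ^ (2 * n - 1) = 2 * x * ?i * (real (2 * n) * ?i ^ (2 * n))"
    by (simp add: power2_eq_square algebra_simps)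
  have "std_bump (Suc n) x =
      (?p' * w\<^sup>2 + ?p * (real (4 * n) * x * w - 2 * x)) * ?i ^ (2 * n) * ?i\<^sup>2 * ?e"
    using assms by (simp add: std_bump_def w_def power2_eq_square algebra_simps)
  also have "\<dots> = (?p' * (w * ?i)\<^sup>2 + ?p * (2 * x * ?i * (w * ?i) * real (2 * n) - 2 * x * ?i\<^sup>2)) * ?i ^ (2 * n) * ?e"
    by (simp add: power2_eq_square algebra_simps)
  also have "\<dots> = (?p' * ?i ^ (2 * n) + 2 * x * ?i * (real (2 * n) * ?i ^ (2 * n)) * ?p) * ?e +
      ?e * (- (2 * x * ?i\<^sup>2)) * (?p * ?i ^ (2 * n))"
    using w by (simp add: algebra_simps)
  finally have "(?f has_real_derivative std_bump (Suc n) x) (at x)"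
    using D unfolding e1 by simp
  then show ?thesis
    by (rule has_field_derivative_transform_within_open[of _ _ _ "{-1<..<1}"])
       (use assms in \<open>auto simp: std_bump_def\<close>)
qed

lemma smooth_bump_std_bump: "smooth_bump std_bump"
  unfolding smooth_bump_def
proof (intro conjI allI impI)
  fix n :: nat and x :: real
  consider "\<bar>x\<bar> < 1" | "\<bar>x\<bar> = 1" | "\<bar>x\<bar> > 1" by linarith
  then show "(std_bump n has_real_derivative std_bump (Suc n) x) (at x)"
  proof cases
    case 1
    then show ?thesis by (rule std_bump_deriv_inside)
  next
    case 2
    obtain C where C: "\<And>t. \<bar>std_bump n t\<bar> \<le> C * (1 - t\<^sup>2)\<^sup>2"
      using std_bump_quadratic_bound by blast
    have "x\<^sup>2 = 1" using 2 by (simp add: abs_square_eq_1)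
    \<comment> \<open>Since \<open>x\<^sup>2 = 1\<close>,
      \<open>1 - (x + h)\<^sup>2 = - h * (2 * x + h)\<close>, so the increment is of order
      \<open>h\<^sup>2\<close>.\<close>
    then have e: "(1 - (x + h)\<^sup>2)\<^sup>2 = h\<^sup>2 * (2 * x + h)\<^sup>2" for h :: real
      by (simp add: power2_eq_square algebra_simps)
    have "((\<lambda>h. (std_bump n (x + h) - std_bump n x) / h) \<longlongrightarrow> 0) (at 0)"
    proof (rule Lim_null_comparison)
      show "\<forall>\<^sub>F h in at 0. norm ((std_bump n (x + h) - std_bump n x) / h) \<le> C * (\<bar>h\<bar> * (2 * x + h)\<^sup>2)"
      proof (rule eventually_mono[OF eventually_neq_at_within[of 0]])
        fix h :: real assume "h \<noteq> 0"
        moreover have "C * (\<bar>h\<bar> * (2 * x + h)\<^sup>2) * \<bar>h\<bar> = C * (h\<^sup>2 * (2 * x + h)\<^sup>2)"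
          using abs_mult_self_eq[of h] by (simp add: power2_eq_square mult_ac)
        then have "\<bar>std_bump n (x + h)\<bar> \<le> C * (\<bar>h\<bar> * (2 * x + h)\<^sup>2) * \<bar>h\<bar>"
          using C[of "x + h"] unfolding e by presburger
        ultimately show "norm ((std_bump n (x + h) - std_bump n x) / h) \<le> C * (\<bar>h\<bar> * (2 * x + h)\<^sup>2)"
          using 2 by (simp add: std_bump_def[of n x] pos_divide_le_eq)
      qed
      show "((\<lambda>h. C * (\<bar>h\<bar> * (2 * x + h)\<^sup>2)) \<longlongrightarrow> 0) (at 0)"
        by (rule tendsto_eq_intros refl | simp)+
    qed
    then show ?thesis using 2 by (simp add: DERIV_def std_bump_def[of "Suc n" x])
  next
    case 3
    have "((\<lambda>_. 0) has_real_derivative 0) (at x)" by simp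
    then have "(std_bump n has_real_derivative 0) (at x)"
      by (rule has_field_derivative_transform_within_open[of _ _ _ "- {-1..1}"])
         (use 3 in \<open>auto simp: std_bump_def\<close>)
    then show ?thesis using 3 by (simp add: std_bump_def[of "Suc n" x])
  qed
qed (simp add: std_bump_def)

text \<open>A dilation of \<open>std_bump\<close>; the chain rule puts \<open>\<epsilon> ^ n\<close>
  into the denominator, and \<open>\<epsilon> \<le> 1\<close> keeps the support inside
  [-1, 1].\<close>

lemma smooth_bump_concentrated:
  fixes \<epsilon> :: real
  assumes "0 < \<epsilon>" "\<epsilon> \<le> 1"
  obtains D where "smooth_bump D" "\<And>x. D 0 x \<ge> 0" "D 0 0 > 0" "\<And>x. \<epsilon> \<le> \<bar>x\<bar> \<Longrightarrow> D 0 x = 0"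
proof
  let ?D = "\<lambda>n x. std_bump n (x / \<epsilon>) / \<epsilon> ^ n"
  have der: "(std_bump n has_real_derivative std_bump (Suc n) x) (at x)"
    and supp: "1 \<le> \<bar>x\<bar> \<Longrightarrow> std_bump n x = 0" for n x
    using smooth_bump_std_bump by (auto simp: smooth_bump_def)
  show "smooth_bump ?D"
    unfolding smooth_bump_def
  proof (intro conjI allI impI)
    fix n x
    have "((\<lambda>x. std_bump n (x / \<epsilon>)) has_real_derivative std_bump (Suc n) (x / \<epsilon>) * (1 / \<epsilon>)) (at x)"
      by (rule DERIV_chain2[OF der]) (use assms in \<open>auto intro!: derivative_eq_intros\<close>)
    then have "(?D n has_real_derivative (std_bump (Suc n) (x / \<epsilon>) * (1 / \<epsilon>)) / \<epsilon> ^ n) (at x)"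
      by (rule DERIV_cdivide)
    then show "(?D n has_real_derivative ?D (Suc n) x) (at x)" by (simp add: field_simps)
  next
    fix n and x :: real assume "1 \<le> \<bar>x\<bar>"
    then show "?D n x = 0" using assms by (subst supp) (auto simp: field_simps)
  qed
  show "?D 0 x = 0" if "\<epsilon> \<le> \<bar>x\<bar>" for x
    using that assms by (subst supp) (auto simp: field_simps)
qed (use assms in \<open>auto simp: std_bump_def abs_square_less_1\<close>)

lemma smooth_bump_continuous:
  assumes "smooth_bump D"
  shows "continuous_on S (D n)"
  by (rule DERIV_continuous_on[OF has_field_derivative_at_within])
     (use assms in \<open>auto simp: smooth_bump_def\<close>)

lemma smooth_bump_bounded:
  assumes "smooth_bump D"
  obtains B where "B > 0" "\<And>x. \<bar>D n x\<bar> \<le> B"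
proof -
  have "compact (D n ` {-1..1})"
    using assms by (intro compact_continuous_image smooth_bump_continuous) auto
  then obtain B where B: "\<And>x. \<bar>x\<bar> \<le> 1 \<Longrightarrow> \<bar>D n x\<bar> \<le> B"
    by (force simp: bounded_iff dest!: compact_imp_bounded)
  have "\<bar>D n x\<bar> \<le> \<bar>B\<bar> + 1" for x
    using B[of x] assms by (cases "\<bar>x\<bar> \<le> 1") (auto simp: smooth_bump_def)
  then show thesis using that[of "\<bar>B\<bar> + 1"] by auto
qed

section \<open>Mollification along horizontal lines\<close>

text \<open>Convolution along the real direction; horizontal shifts preserve the half-plane. The
  gauge integral over a fixed compact interval suits the Leibniz rule.\<close>

definition hconv :: "(complex \<Rightarrow> complex) \<Rightarrow> (real \<Rightarrow> real) \<Rightarrow> complex \<Rightarrow> complex" where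
  "hconv F p z = integral {-1..1} (\<lambda>s. F (z - of_real s) * of_real (p s))"

lemma open_upper_half_plane: "open upper_half_plane"
  unfolding upper_half_plane_def by (rule open_halfspace_Im_gt)

lemma convex_upper_half_plane: "convex upper_half_plane"
  unfolding upper_half_plane_def by (rule convex_halfspace_Im_gt)

lemma diff_of_real_in_upper_half_plane [simp]:
  "z - of_real s \<in> upper_half_plane \<longleftrightarrow> z \<in> upper_half_plane"
  by (simp add: upper_half_plane_def)

lemma hconv_integrand_continuous:
  fixes F :: "complex \<Rightarrow> complex" and p :: "real \<Rightarrow> real"
  assumes "continuous_on upper_half_plane F" "continuous_on S p" "z \<in> upper_half_plane"
  shows "continuous_on S (\<lambda>s. F (z - of_real s) * of_real (p s))"
  by (intro continuous_intros continuous_on_compose2[OF assms(1)] assms(2)) (use assms(3) in auto)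

lemma hconv_has_field_derivative:
  assumes F: "F holomorphic_on upper_half_plane" and p: "continuous_on {-1..1} p"
    and z: "z \<in> upper_half_plane"
  shows "(hconv F p has_field_derivative hconv (deriv F) p z) (at z)"
proof -
  have dF: "deriv F holomorphic_on upper_half_plane"
    using F open_upper_half_plane by (rule holomorphic_deriv)
  have "((\<lambda>x. integral (cbox (-1) 1) (\<lambda>s. F (x - of_real s) * of_real (p s))) has_field_derivative
      integral (cbox (-1) 1) (\<lambda>s. deriv F (z - of_real s) * of_real (p s))) (at z within upper_half_plane)"
  proof (rule leibniz_rule_field_derivative)
    fix x :: complex and t :: real assume x: "x \<in> upper_half_plane"
    have d1: "(F has_field_derivative deriv F (x - of_real t)) (at (x - of_real t))"
      using F open_upper_half_plane x by (intro holomorphic_derivI) auto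
    have d2: "((\<lambda>x. x - of_real t :: complex) has_field_derivative 1) (at x)"
      by (auto intro!: derivative_eq_intros)
    have "((\<lambda>x. F (x - of_real t)) has_field_derivative deriv F (x - of_real t)) (at x)"
      using DERIV_chain2[OF d1 d2] by simp
    then show "((\<lambda>x. F (x - of_real t) * of_real (p t)) has_field_derivative
        deriv F (x - of_real t) * of_real (p t)) (at x within upper_half_plane)"
      by (rule has_field_derivative_at_within[OF DERIV_cmult_right])
  next
    fix x :: complex assume x: "x \<in> upper_half_plane"
    show "(\<lambda>s. F (x - of_real s) * of_real (p s)) integrable_on cbox (-1) 1"
      by (rule integrable_continuous[OF hconv_integrand_continuous[OF holomorphic_on_imp_continuous_on[OF F] _ x]])
        (use p in simp)
  next
    have "continuous_on (upper_half_plane \<times> cbox (-1) 1) (\<lambda>w. deriv F (fst w - of_real (snd w)))"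
      by (rule continuous_on_compose2[OF holomorphic_on_imp_continuous_on[OF dF]])
        (auto intro!: continuous_intros)
    moreover have "continuous_on (upper_half_plane \<times> cbox (-1) 1) (\<lambda>w. p (snd w))"
      by (rule continuous_on_compose2[OF p]) (auto intro!: continuous_intros)
    ultimately show "continuous_on (upper_half_plane \<times> cbox (-1) 1) (\<lambda>(x, t). deriv F (x - of_real t) * of_real (p t))"
      unfolding split_beta by (intro continuous_intros)
  qed (use z convex_upper_half_plane in auto)
  then show ?thesis
    using at_within_open[OF z open_upper_half_plane] by (simp add: hconv_def[abs_def])
qed

lemma hconv_holomorphic:
  assumes "F holomorphic_on upper_half_plane" "continuous_on {-1..1} p"
  shows "hconv F p holomorphic_on upper_half_plane"
  using hconv_has_field_derivative[OF assms] open_upper_half_plane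
  by (auto simp: holomorphic_on_open)

lemma hconv_higher_deriv:
  assumes F: "F holomorphic_on upper_half_plane" and p: "continuous_on {-1..1} p"
    and z: "z \<in> upper_half_plane"
  shows "(deriv ^^ n) (hconv F p) z = hconv ((deriv ^^ n) F) p z"
  using z
proof (induction n arbitrary: z)
  case (Suc n)
  have hol: "(deriv ^^ n) F holomorphic_on upper_half_plane"
    using F open_upper_half_plane by (rule holomorphic_higher_deriv)
  have "deriv ((deriv ^^ n) (hconv F p)) z = deriv (hconv ((deriv ^^ n) F) p) z"
    by (rule complex_derivative_transform_within_open[of _ upper_half_plane])
      (use Suc hol F p open_upper_half_plane in
        \<open>auto intro!: hconv_holomorphic holomorphic_higher_deriv\<close>)
  also have "\<dots> = hconv (deriv ((deriv ^^ n) F)) p z"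
    by (intro DERIV_imp_deriv hconv_has_field_derivative hol p Suc.prems)
  finally show ?case by simp
qed simp

text \<open>Differentiating \<open>F (z - of_real s)\<close> in \<open>s\<close> gives a minus sign
  that cancels the one from integration by parts; the boundary terms vanish with
  \<open>p\<close>.\<close>

lemma hconv_by_parts:
  assumes F: "F holomorphic_on upper_half_plane"
    and p: "\<And>x. (p has_real_derivative p' x) (at x)" and p': "continuous_on {-1..1} p'"
    and bdry: "p (-1) = 0" "p 1 = 0" and z: "z \<in> upper_half_plane"
  shows "hconv (deriv F) p z = hconv F p' z"
proof -
  have contp: "continuous_on {-1..1} p"
    by (rule DERIV_continuous_on[OF has_field_derivative_at_within[OF p]])
  have dF: "deriv F holomorphic_on upper_half_plane"
    using F open_upper_half_plane by (rule holomorphic_deriv)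
  have "((\<lambda>s. F (z - of_real s) * of_real (p s)) has_vector_derivative
      F (z - of_real s) * of_real (p' s) + (- deriv F (z - of_real s)) * of_real (p s)) (at s within {-1..1})" for s
  proof (rule has_vector_derivative_mult)
    have "(F has_field_derivative deriv F (z - of_real s)) (at (z - of_real s))"
      using F open_upper_half_plane z by (intro holomorphic_derivI) auto
    moreover have "((\<lambda>s. z - of_real s) has_vector_derivative - 1) (at s within {-1..1})"
      by (auto intro!: derivative_eq_intros)
    ultimately show "((\<lambda>s. F (z - of_real s)) has_vector_derivative - deriv F (z - of_real s)) (at s within {-1..1})"
      using field_vector_diff_chain_within[of "\<lambda>s. z - of_real s" "-1" s "{-1..1}" F "deriv F (z - of_real s)"]
      by (auto simp: o_def intro: has_field_derivative_at_within)
    show "((\<lambda>s. of_real (p s)) has_vector_derivative of_real (p' s)) (at s within {-1..1})"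
      by (rule has_vector_derivative_of_real[OF has_field_derivative_at_within[OF p]])
  qed
  then have int0: "((\<lambda>s. F (z - of_real s) * of_real (p' s) + (- deriv F (z - of_real s)) * of_real (p s)) has_integral
      (F (z - of_real 1) * of_real (p 1) - F (z - of_real (-1)) * of_real (p (-1)))) {-1..1}"
    by (intro fundamental_theorem_of_calculus) auto
  have int1: "((\<lambda>s. F (z - of_real s) * of_real (p' s)) has_integral hconv F p' z) {-1..1}"
    unfolding hconv_def using F z p'
    by (intro integrable_integral integrable_continuous_real hconv_integrand_continuous
        holomorphic_on_imp_continuous_on)
  have "((\<lambda>s. deriv F (z - of_real s) * of_real (p s)) has_integral hconv (deriv F) p z) {-1..1}"
    unfolding hconv_def using dF z contp
    by (intro integrable_integral integrable_continuous_real hconv_integrand_continuous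
        holomorphic_on_imp_continuous_on)
  then have "((\<lambda>s. F (z - of_real s) * of_real (p' s) + (- deriv F (z - of_real s)) * of_real (p s)) has_integral
      hconv F p' z - hconv (deriv F) p z) {-1..1}"
    using has_integral_diff[OF int1] by simp
  with int0 have "F (z - of_real 1) * of_real (p 1) - F (z - of_real (-1)) * of_real (p (-1)) =
      hconv F p' z - hconv (deriv F) p z"
    by (rule has_integral_unique)
  then show ?thesis using bdry by simp
qed

lemma Re_hconv:
  assumes "continuous_on upper_half_plane F" "continuous_on {-1..1} p" "z \<in> upper_half_plane"
  shows "((\<lambda>s. Re (F (z - of_real s)) * p s) has_integral Re (hconv F p z)) {-1..1}"
proof -
  have "((\<lambda>s. F (z - of_real s) * of_real (p s)) has_integral hconv F p z) {-1..1}"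
    unfolding hconv_def using assms
    by (intro integrable_integral integrable_continuous_real hconv_integrand_continuous)
  then have "((\<lambda>s. Re (F (z - of_real s) * of_real (p s))) has_integral Re (hconv F p z)) {-1..1}"
    by (rule has_integral_linear[OF _ bounded_linear_Re, unfolded o_def])
  then show ?thesis by simp
qed

lemma Re_hconv_le:
  assumes "continuous_on upper_half_plane F" "continuous_on {-1..1} p" "z \<in> upper_half_plane"
    and B: "\<And>s. \<bar>p s\<bar> \<le> B" and m: "\<And>s. \<bar>s\<bar> \<le> 1 \<Longrightarrow> \<bar>Re (F (z - of_real s))\<bar> \<le> m"
  shows "\<bar>Re (hconv F p z)\<bar> \<le> 2 * B * m"
proof -
  have m0: "0 \<le> m" using m[of 0] by linarith
  have B0: "0 \<le> B" using B[of 0] by linarith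
  have "norm (Re (hconv F p z)) \<le> (m * B) * measure lborel (cbox (-1::real) 1)"
    by (rule has_integral_bound[where f = "\<lambda>s. Re (F (z - of_real s)) * p s"])
      (use Re_hconv[OF assms(1-3)] m B m0 B0 in \<open>auto simp: abs_mult intro!: mult_mono\<close>)
  then show ?thesis by (simp add: mult_ac)
qed

text \<open>Turns the gauge integral into the Lebesgue pairing of \<open>Re F\<close> on a
  horizontal line with the reflected translate \<open>p (x - t)\<close>, the form in which the
  boundary condition applies.\<close>

lemma Re_hconv_lborel:
  assumes F: "continuous_on upper_half_plane F" and p: "continuous_on UNIV p"
    and supp: "\<And>s. 1 \<le> \<bar>s\<bar> \<Longrightarrow> p s = 0" and y: "0 < y"
  shows "Re (hconv F p (Complex x y)) = (\<integral>t. Re (F (Complex t y)) * p (x - t) \<partial>lborel)"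
proof -
  let ?z = "Complex x y"
  have z: "?z \<in> upper_half_plane" using y by (simp add: upper_half_plane_def)
  let ?g = "\<lambda>s. Re (F (?z - of_real s)) * p s"
  have ci: "continuous_on {-1..1} ?g"
    by (intro continuous_intros continuous_on_compose2[OF F] continuous_on_subset[OF p]) (use z in auto)
  have ind: "(\<lambda>s. indicator {-1..1} s *\<^sub>R ?g s) = ?g"
  proof
    show "indicator {-1..1} s *\<^sub>R ?g s = ?g s" for s
      using supp[of s] by (cases "s \<in> {-1..1}") auto
  qed
  have int: "integrable lborel ?g"
    using borel_integrable_compact[OF compact_Icc ci] unfolding ind .
  have "(?g has_integral integral\<^sup>L lborel ?g) UNIV"
    using has_integral_integral_lborel[OF int] .
  moreover have "(?g has_integral Re (hconv F p ?z)) UNIV"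
  proof (rule has_integral_on_superset)
    show "(?g has_integral Re (hconv F p ?z)) {-1..1}"
      by (rule Re_hconv[OF F continuous_on_subset[OF p] z]) auto
    show "?g s = 0" if "s \<notin> {-1..1}" for s
      using supp[of s] that by auto
  qed auto
  ultimately have "Re (hconv F p ?z) = integral\<^sup>L lborel ?g" by (simp add: has_integral_unique)
  also have "\<dots> = (\<integral>t. ?g (x + (-1) * t) \<partial>lborel)"
    using lborel_integral_real_affine[of "-1" ?g x] by simp
  also have "(\<lambda>t. ?g (x + (-1) * t)) = (\<lambda>t. Re (F (Complex t y)) * p (x - t))"
  proof
    fix t :: real
    have "?z - of_real (x - t) = Complex t y" by (simp add: complex_eq_iff)
    then show "?g (x + (-1) * t) = Re (F (Complex t y)) * p (x - t)" by simp
  qed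
  finally show ?thesis .
qed

section \<open>Uniform bounds from the distributional boundary condition\<close>

text \<open>Sokal's argument for uniform boundedness on \<open>l\<^sup>1\<close>: along \<open>Y n \<rightarrow> 0\<close> with \<open>4 ^ n < sup \<bar>F (\<cdot>) (Y n)\<bar>\<close>, attained at
  \<open>X n\<close>, the sign of \<open>a n = \<plusminus> 3\<^bsup>-n\<^esup>\<close> is chosen so that the \<open>n\<close>-th term does not cancel against the earlier ones,
  and the later terms are too small to compensate it.\<close>

lemma gliding_hump:
  fixes F :: "real \<Rightarrow> real \<Rightarrow> real"
  assumes K: "compact K" "K \<noteq> {}"
    and cont: "\<And>y. y > 0 \<Longrightarrow> continuous_on K (\<lambda>x. F x y)"
    and lim: "\<And>a X. (\<And>j. \<bar>a j\<bar> \<le> (1/3) ^ j) \<Longrightarrow> (\<And>j. X j \<in> K) \<Longrightarrow>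
      ((\<lambda>y. \<Sum>j. a j * F (X j) y) \<longlongrightarrow> 0) (at_right 0)"
  shows "\<exists>M. \<exists>\<delta>>0. \<forall>y\<in>{0<..<\<delta>}. \<forall>x\<in>K. \<bar>F x y\<bar> \<le> M"
proof (rule ccontr)
  assume neg: "\<nexists>M. \<exists>\<delta>>0. \<forall>y\<in>{0<..<\<delta>}. \<forall>x\<in>K. \<bar>F x y\<bar> \<le> M"
  have "\<exists>x y. 0 < y \<and> y < 1 / real (Suc n) \<and> x \<in> K \<and> 4 ^ n < \<bar>F x y\<bar> \<and> (\<forall>x'\<in>K. \<bar>F x' y\<bar> \<le> \<bar>F x y\<bar>)" for n
  proof -
    have "\<not> (\<forall>y\<in>{0<..<1 / real (Suc n)}. \<forall>x\<in>K. \<bar>F x y\<bar> \<le> 4 ^ n)"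
      using neg by (metis zero_less_divide_1_iff of_nat_0_less_iff zero_less_Suc)
    then obtain x0 y where y: "0 < y" "y < 1 / real (Suc n)" "x0 \<in> K" "\<bar>F x0 y\<bar> > 4 ^ n"
      by force
    obtain x where "x \<in> K" "\<forall>x'\<in>K. \<bar>F x' y\<bar> \<le> \<bar>F x y\<bar>"
      using continuous_attains_sup[OF K continuous_on_rabs[OF cont[OF y(1)]]] by blast
    with y show ?thesis by (meson less_le_trans)
  qed
  then obtain X Y where Y: "\<And>n. 0 < Y n" "\<And>n. Y n < 1 / real (Suc n)" and X: "\<And>n. X n \<in> K"
    and big: "\<And>n. 4 ^ n < \<bar>F (X n) (Y n)\<bar>"
    and mx: "\<And>n x'. x' \<in> K \<Longrightarrow> \<bar>F x' (Y n)\<bar> \<le> \<bar>F (X n) (Y n)\<bar>"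
    by metis
  define c :: "nat \<Rightarrow> (real \<Rightarrow> real) \<Rightarrow> real" where
    "c = (\<lambda>n g. (if g (Y n) * F (X n) (Y n) \<ge> 0 then 1 else -1) * (1/3) ^ n)"
  \<comment> \<open>The recursion carries the partial sum as a function of \<open>y\<close>, because
    the sign of the next coefficient depends on its value at the new height
    \<open>Y n\<close>.\<close>
  define S where "S = rec_nat (\<lambda>_. 0) (\<lambda>n g y. g y + c n g * F (X n) y)"
  define a where "a n = c n (S n)" for n
  have S_sum: "S n y = (\<Sum>j<n. a j * F (X j) y)" for n y
    by (induction n) (auto simp: S_def a_def)
  have a: "\<bar>a n\<bar> = (1/3) ^ n" for n
    by (simp add: a_def c_def abs_mult)
  define T where "T y = (\<Sum>j. a j * F (X j) y)" for y
  have geo: "(\<lambda>j. (1/3::real) ^ j) sums (3/2)"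
    using geometric_sums[of "1/3::real"] by simp
  have lower: "\<bar>T (Y n)\<bar> \<ge> 1/2" for n
  proof -
    define m where "m = \<bar>F (X n) (Y n)\<bar>"
    have tm: "norm (a j * F (X j) (Y n)) \<le> (1/3) ^ j * m" for j
      using mx[OF X[of j], of n] by (simp add: abs_mult a m_def mult_left_mono)
    have s1: "summable (\<lambda>j. (1/3::real) ^ j * m)"
      using geo by (intro summable_mult2) (auto simp: sums_iff)
    have sm: "summable (\<lambda>j. a j * F (X j) (Y n))"
      by (rule summable_comparison_test'[OF s1]) (use tm in auto)
    have spl: "T (Y n) = (\<Sum>j. a (j + Suc n) * F (X (j + Suc n)) (Y n)) + S (Suc n) (Y n)"
      unfolding T_def S_sum by (rule suminf_split_initial_segment[OF sm])
    \<comment> \<open>The terms after the \<open>n\<close>-th amount to at most half of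
      \<open>(1/3) ^ n * m\<close>, so half of it survives, and
      \<open>(4/3) ^ n \<ge> 1\<close>.\<close>
    have "(\<lambda>j. (1/3::real) ^ j * ((1/3) ^ Suc n * m)) sums (3/2 * ((1/3) ^ Suc n * m))"
      using geo by (rule sums_mult2)
    then have s2: "(\<lambda>j. (1/3::real) ^ (j + Suc n) * m) sums ((1/3) ^ n * m / 2)"
      by (simp add: power_add mult_ac)
    have "norm (\<Sum>j. a (j + Suc n) * F (X (j + Suc n)) (Y n)) \<le> (\<Sum>j. (1/3::real) ^ (j + Suc n) * m)"
      using s2 by (intro norm_suminf_le tm) (auto simp: sums_iff)
    then have tail: "\<bar>\<Sum>j. a (j + Suc n) * F (X (j + Suc n)) (Y n)\<bar> \<le> (1/3) ^ n * m / 2"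
      using s2 by (simp add: sums_iff)
    have Ssuc: "S (Suc n) (Y n) = S n (Y n) + a n * F (X n) (Y n)"
      by (simp add: S_sum)
    have "S n (Y n) * (a n * F (X n) (Y n)) = (S n (Y n) * F (X n) (Y n)) * a n" by simp
    also have "\<dots> \<ge> 0" by (auto simp: a_def c_def mult_nonpos_nonneg mult_nonneg_nonpos)
    finally have "\<bar>S (Suc n) (Y n)\<bar> \<ge> \<bar>a n * F (X n) (Y n)\<bar>"
      unfolding Ssuc by (auto simp: zero_le_mult_iff)
    then have "\<bar>S (Suc n) (Y n)\<bar> \<ge> (1/3) ^ n * m" by (simp add: abs_mult a m_def)
    with tail spl have "\<bar>T (Y n)\<bar> \<ge> (1/3) ^ n * m / 2" by linarith
    moreover have "(1/3) ^ n * m \<ge> (1/3::real) ^ n * 4 ^ n"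
      using big[of n] by (intro mult_left_mono) (auto simp: m_def)
    moreover have "(1/3::real) ^ n * 4 ^ n \<ge> 1"
      unfolding power_mult_distrib[symmetric] by (intro one_le_power) auto
    ultimately show ?thesis by linarith
  qed
  have "(T \<longlongrightarrow> 0) (at_right 0)"
    unfolding T_def by (rule lim) (use a X in auto)
  moreover have "filterlim Y (at_right 0) sequentially"
  proof (rule tendsto_imp_filterlim_at_right)
    have "(\<lambda>n. 1 / real (Suc n)) \<longlonglongrightarrow> 0"
      using LIMSEQ_inverse_real_of_nat by (simp add: inverse_eq_divide)
    then show "Y \<longlonglongrightarrow> 0"
      by (rule tendsto_sandwich[of "\<lambda>_. 0", rotated 3, OF _ _ _ ]) 
         (use Y in \<open>auto intro!: always_eventually less_imp_le\<close>)
  qed (use Y in auto)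
  ultimately have "(\<lambda>n. T (Y n)) \<longlonglongrightarrow> 0" by (rule filterlim_compose)
  then have "(\<lambda>n. \<bar>T (Y n)\<bar>) \<longlonglongrightarrow> 0" by (rule tendsto_rabs_zero)
  then have "1 / 2 \<le> (0::real)"
    by (rule tendsto_lowerbound) (use lower in auto)
  then show False by simp
qed

text \<open>On the real line the iterated partial derivatives of \<open>Ck_on\<close> walk along the
  sequence \<open>\<Psi>\<close>, so the induction on \<open>k\<close> runs over all
  \<open>n\<close> at once.\<close>

lemma test_function_of_real:
  assumes der: "\<And>n x. (\<Psi> n has_real_derivative \<Psi> (Suc n) x) (at x)"
    and supp: "\<And>x. r < \<bar>x\<bar> \<Longrightarrow> \<Psi> 0 x = 0"
  shows "test_function (\<lambda>x. of_real (\<Psi> 0 x))"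
proof -
  have vd: "((\<lambda>t. of_real (\<Psi> n (x + t)) :: complex) has_vector_derivative of_real (\<Psi> (Suc n) x)) (at 0)" for n x
  proof -
    have "((\<lambda>t. \<Psi> n (x + t)) has_real_derivative \<Psi> (Suc n) x) (at 0)"
      using der[of n x] by (simp add: DERIV_def)
    then show ?thesis
      by (intro has_vector_derivative_of_real) (simp add: has_real_derivative_iff_has_vector_derivative)
  qed
  have cont\<Psi>: "continuous_on UNIV (\<Psi> n)" for n
    by (rule DERIV_continuous_on[OF has_field_derivative_at_within[OF der]])
  have cont: "continuous_on UNIV (\<lambda>x. of_real (\<Psi> n x) :: complex)" for n
    by (intro continuous_on_of_real cont\<Psi>)
  have pd: "partial_deriv 1 (\<lambda>x. of_real (\<Psi> n x) :: complex) = (\<lambda>x. of_real (\<Psi> (Suc n) x))" for n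
    using vector_derivative_at[OF vd] by (simp add: partial_deriv_def fun_eq_iff)
  have "Ck_on k (\<lambda>x. of_real (\<Psi> n x) :: complex) UNIV" for k n
  proof (induction k arbitrary: n)
    case (Suc k)
    then show ?case using differentiableI_vector[OF vd] cont by (simp add: pd)
  qed (simp add: cont\<Psi>)
  moreover have "bounded {x. complex_of_real (\<Psi> 0 x) \<noteq> 0}"
    using supp by (intro boundedI[of _ r]) (force simp: not_less[symmetric])
  ultimately show ?thesis by (simp add: test_function_def)
qed

lemma smooth_bump_shift: "smooth_bump D \<Longrightarrow> smooth_bump (\<lambda>k. D (n + k))"
  by (auto simp: smooth_bump_def)

text \<open>The boundary condition for the real part alone, tested with real-valued functions: the
  form needed to combine real coefficients with chosen signs.\<close>

definition zero_boundary_Re :: "(complex \<Rightarrow> complex) \<Rightarrow> bool" where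
  "zero_boundary_Re F \<longleftrightarrow> (\<forall>\<psi>. test_function (\<lambda>x. of_real (\<psi> x)) \<longrightarrow>
     ((\<lambda>y. \<integral>t. Re (F (Complex t y)) * \<psi> t \<partial>lborel) \<longlongrightarrow> 0) (at_right 0))"

text \<open>Termwise differentiation, justified by the majorant \<open>(1/3) ^ j * B\<close>. The
  sign \<open>(-1) ^ n\<close> collects the inner derivatives of \<open>X j - t\<close>.\<close>

lemma translate_series_derivative:
  fixes X :: "nat \<Rightarrow> real"
  assumes D: "smooth_bump D" and a: "\<And>j. \<bar>a j\<bar> \<le> (1/3) ^ j"
  defines "\<Psi> \<equiv> \<lambda>n t. (-1) ^ n * (\<Sum>j. a j * D n (X j - t))"
  shows "(\<Psi> n has_real_derivative \<Psi> (Suc n) t) (at t)"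
proof -
  obtain B where B: "B > 0" "\<And>x. \<bar>D (Suc n) x\<bar> \<le> B" using smooth_bump_bounded[OF D] by blast
  obtain B0 where B0: "B0 > 0" "\<And>x. \<bar>D n x\<bar> \<le> B0" using smooth_bump_bounded[OF D] by blast
  have geo: "summable (\<lambda>j. (1/3::real) ^ j * c)" for c
    by (intro summable_mult2 summable_geometric) auto
  have le: "norm (a j * d) \<le> (1/3) ^ j * c" if "\<bar>d\<bar> \<le> c" for j d c
    using a[of j] that by (simp add: abs_mult mult_mono)
  have der: "((\<lambda>t. a j * D n (X j - t)) has_real_derivative - (a j * D (Suc n) (X j - t))) (at t)" for j t
  proof -
    have "(D n has_real_derivative D (Suc n) (X j - t)) (at (X j - t))"
      using D by (simp add: smooth_bump_def)
    then have "((\<lambda>t. D n (X j - t)) has_real_derivative D (Suc n) (X j - t) * (-1)) (at t)"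
      by (rule DERIV_chain2) (auto intro!: derivative_eq_intros)
    from DERIV_cmult[OF this, of "a j"] show ?thesis by simp
  qed
  have "((\<lambda>t. \<Sum>j. a j * D n (X j - t)) has_real_derivative (\<Sum>j. - (a j * D (Suc n) (X j - t)))) (at t)"
  proof (rule has_field_derivative_series'(2)[where S = UNIV and x0 = t])
    show "uniformly_convergent_on UNIV (\<lambda>n' x. \<Sum>i<n'. - (a i * D (Suc n) (X i - x)))"
      by (rule Weierstrass_m_test'[OF _ geo[of B]]) (use le[OF B(2)] in simp)
    show "summable (\<lambda>j. a j * D n (X j - t))"
      by (rule summable_comparison_test'[OF geo[of B0]]) (use le[OF B0(2)] in simp)
  qed (auto intro: der)
  moreover have "summable (\<lambda>j. a j * D (Suc n) (X j - t))"
    by (rule summable_comparison_test'[OF geo[of B]]) (use le[OF B(2)] in simp)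
  ultimately have "((\<lambda>t. \<Sum>j. a j * D n (X j - t)) has_real_derivative - (\<Sum>j. a j * D (Suc n) (X j - t))) (at t)"
    by (simp add: suminf_minus)
  from DERIV_cmult[OF this, of "(-1) ^ n"] show ?thesis by (simp add: \<Psi>_def)
qed

text \<open>Translates of one bump, summed with absolutely summable coefficients, form again a test function.
  So the boundary condition holds for the whole series, which is what the gliding hump needs.\<close>

lemma Re_hconv_series_tendsto_0:
  assumes F: "F holomorphic_on upper_half_plane" and bv: "zero_boundary_Re F"
    and D: "smooth_bump D" and a: "\<And>j. \<bar>a j\<bar> \<le> (1/3) ^ j" and X: "\<And>j. \<bar>X j\<bar> \<le> r"
  shows "((\<lambda>y. \<Sum>j. a j * Re (hconv F (D 0) (Complex (X j) y))) \<longlongrightarrow> 0) (at_right 0)"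
proof -
  define \<Psi> where "\<Psi> = (\<lambda>n t. (-1) ^ n * (\<Sum>j. a j * D n (X j - t)))"
  have contF: "continuous_on upper_half_plane F" by (rule holomorphic_on_imp_continuous_on[OF F])
  have supp: "D 0 (X j - t) = 0" if "r + 1 < \<bar>t\<bar>" for j t
    using D X[of j] that by (auto simp: smooth_bump_def)
  obtain B where B: "B > 0" "\<And>x. \<bar>D 0 x\<bar> \<le> B" using smooth_bump_bounded[OF D] by blast
  have "test_function (\<lambda>x. of_real (\<Psi> 0 x))"
  proof (rule test_function_of_real)
    show "(\<Psi> n has_real_derivative \<Psi> (Suc n) x) (at x)" for n x
      unfolding \<Psi>_def using D a by (rule translate_series_derivative)
    show "\<Psi> 0 x = 0" if "r + 1 < \<bar>x\<bar>" for x using supp[OF that] by (simp add: \<Psi>_def)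
  qed
  then have lim: "((\<lambda>y. \<integral>t. Re (F (Complex t y)) * \<Psi> 0 t \<partial>lborel) \<longlongrightarrow> 0) (at_right 0)"
    using bv by (simp add: zero_boundary_Re_def)
  have "(\<integral>t. Re (F (Complex t y)) * \<Psi> 0 t \<partial>lborel) = (\<Sum>j. a j * Re (hconv F (D 0) (Complex (X j) y)))"
    if y: "0 < y" for y
  proof -
    let ?v = "\<lambda>t. Re (F (Complex t y))"
    \<comment> \<open>All translates of the bump live in \<open>?I\<close>, as
      \<open>\<bar>X j\<bar> \<le> r\<close>. Hence \<open>?w\<close> is integrable and dominates
      the \<open>j\<close>-th term up to the factor \<open>(1/3) ^ j\<close>, which permits
      exchanging sum and integral.\<close>
    let ?I = "{- (r + 1)..r + 1}"
    let ?w = "\<lambda>t. indicator ?I t *\<^sub>R (\<bar>?v t\<bar> * B)"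
    let ?f = "\<lambda>j t. ?v t * (a j * D 0 (X j - t))"
    have contv: "continuous_on S ?v" for S
      unfolding Complex_eq
      by (intro continuous_intros continuous_on_compose2[OF contF]) (use y in \<open>auto simp: upper_half_plane_def\<close>)
    have contD: "continuous_on S (\<lambda>t. D 0 (x - t))" for S x
      by (rule continuous_on_compose2[OF smooth_bump_continuous[OF D, of UNIV]]) (auto intro!: continuous_intros)
    have intw: "integrable lborel ?w"
      by (intro borel_integrable_compact continuous_intros contv) auto
    have intf: "integrable lborel (?f j)" for j
    proof -
      have "integrable lborel (\<lambda>t. indicator ?I t *\<^sub>R ?f j t)"
        by (intro borel_integrable_compact continuous_intros contv contD) auto
      moreover have "(\<lambda>t. indicator ?I t *\<^sub>R ?f j t) = ?f j"
        using supp[of _ j] by (force simp: indicator_def fun_eq_iff)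
      ultimately show ?thesis by simp
    qed
    have le: "norm (?f j t) \<le> (1/3) ^ j * ?w t" for j t
    proof (cases "t \<in> ?I")
      case True
      have "\<bar>a j\<bar> * (\<bar>?v t\<bar> * \<bar>D 0 (X j - t)\<bar>) \<le> (1/3) ^ j * (\<bar>?v t\<bar> * B)"
        by (intro mult_mono a mult_left_mono B) auto
      then show ?thesis using True by (simp add: abs_mult mult_ac)
    next
      case False
      then have "r + 1 < \<bar>t\<bar>" by auto
      then show ?thesis using supp[of t j] False by simp
    qed
    have geo: "summable (\<lambda>j. (1/3::real) ^ j * c)" for c
      by (intro summable_mult2 summable_geometric) auto
    have "(\<integral>t. (\<Sum>j. ?f j t) \<partial>lborel) = (\<Sum>j. \<integral>t. ?f j t \<partial>lborel)"
    proof (rule integral_suminf[OF intf])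
      show "AE t in lborel. summable (\<lambda>j. norm (?f j t))"
        by (intro AE_I2 summable_comparison_test'[OF geo[of "?w _"]]) (use le in auto)
      show "summable (\<lambda>j. \<integral>t. norm (?f j t) \<partial>lborel)"
      proof (rule summable_comparison_test'[OF geo[of "integral\<^sup>L lborel ?w"]])
        fix j
        have "(\<integral>t. norm (?f j t) \<partial>lborel) \<le> (\<integral>t. (1/3) ^ j * ?w t \<partial>lborel)"
          by (intro integral_mono integrable_norm intf integrable_mult_right intw le)
        also have "\<dots> = (1/3) ^ j * integral\<^sup>L lborel ?w"
          by (rule integral_mult_right_zero)
        finally show "norm (\<integral>t. norm (?f j t) \<partial>lborel) \<le> (1/3) ^ j * integral\<^sup>L lborel ?w"
          by simp
      qed
    qed
    moreover have "(\<integral>t. ?f j t \<partial>lborel) = a j * Re (hconv F (D 0) (Complex (X j) y))" for j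
    proof -
      have "Re (hconv F (D 0) (Complex (X j) y)) = (\<integral>t. ?v t * D 0 (X j - t) \<partial>lborel)"
        by (rule Re_hconv_lborel[OF contF smooth_bump_continuous[OF D] _ y])
          (use D in \<open>auto simp: smooth_bump_def\<close>)
      moreover have "?f j = (\<lambda>t. a j * (?v t * D 0 (X j - t)))" by (simp add: fun_eq_iff)
      ultimately show ?thesis by simp
    qed
    moreover have "?v t * \<Psi> 0 t = (\<Sum>j. ?f j t)" for t
    proof -
      have "summable (\<lambda>j. a j * D 0 (X j - t))"
        by (rule summable_comparison_test'[OF geo[of B]])
          (use a B in \<open>auto simp: abs_mult intro!: mult_mono\<close>)
      then show ?thesis by (simp add: \<Psi>_def suminf_mult)
    qed
    ultimately show ?thesis by simp
  qed
  then have "\<forall>\<^sub>F y in at_right 0. (\<integral>t. Re (F (Complex t y)) * \<Psi> 0 t \<partial>lborel) =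
      (\<Sum>j. a j * Re (hconv F (D 0) (Complex (X j) y)))"
    by (auto simp: eventually_at_filter)
  then show ?thesis using lim by (rule Lim_transform_eventually[rotated])
qed

lemma Re_hconv_tendsto_0:
  assumes "F holomorphic_on upper_half_plane" "zero_boundary_Re F" "smooth_bump D"
  shows "((\<lambda>y. Re (hconv F (D 0) (Complex x y))) \<longlongrightarrow> 0) (at_right 0)"
proof -
  have "(\<lambda>j. (if j = 0 then 1 else 0) * f j) sums f 0" for f :: "nat \<Rightarrow> real"
    using sums_single[of 0 f] by (rule sums_cong[THEN iffD1, rotated]) simp
  then show ?thesis
    using Re_hconv_series_tendsto_0[OF assms, of "\<lambda>j. if j = 0 then 1 else 0" "\<lambda>_. x" "\<bar>x\<bar>"]
    by (simp add: sums_iff)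
qed

text \<open>Each derivative \<open>D n\<close> is itself a bump once the sequence is shifted, so the
  gliding hump applies to it. For negative \<open>r\<close> there are no points to bound.\<close>

lemma Re_hconv_bounded:
  assumes F: "F holomorphic_on upper_half_plane" and bv: "zero_boundary_Re F" and D: "smooth_bump D"
  shows "\<exists>M. \<exists>\<delta>>0. \<forall>y\<in>{0<..<\<delta>}. \<forall>x\<in>{-r..r}. \<bar>Re (hconv F (D n) (Complex x y))\<bar> \<le> M"
proof (cases "r \<ge> 0")
  case True
  note Dn = smooth_bump_shift[OF D, of n]
  have G: "continuous_on upper_half_plane (hconv F (D n))"
    by (intro holomorphic_on_imp_continuous_on hconv_holomorphic F smooth_bump_continuous[OF D])
  show ?thesis
  proof (rule gliding_hump)
    show "continuous_on {-r..r} (\<lambda>x. Re (hconv F (D n) (Complex x y)))" if "0 < y" for y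
      unfolding Complex_eq
      by (intro continuous_intros continuous_on_compose2[OF G]) (use that in \<open>auto simp: upper_half_plane_def\<close>)
    fix a X :: "nat \<Rightarrow> real"
    assume a: "\<And>j. \<bar>a j\<bar> \<le> (1/3::real) ^ j" and X: "\<And>j. X j \<in> {-r..r}"
    have "\<bar>X j\<bar> \<le> r" for j using X[of j] by (simp add: abs_le_iff)
    then show "((\<lambda>y. \<Sum>j. a j * Re (hconv F (D n) (Complex (X j) y))) \<longlongrightarrow> 0) (at_right 0)"
      using Re_hconv_series_tendsto_0[OF F bv Dn a, of X r] by simp
  qed (use True in auto)
qed (auto intro: exI[of _ 1])

section \<open>Reflection across the real axis\<close>

lemma hconv_bump_has_field_derivative:
  assumes "F holomorphic_on upper_half_plane" "smooth_bump D" "z \<in> upper_half_plane"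
  shows "(hconv F (D n) has_field_derivative hconv F (D (Suc n)) z) (at z)"
proof -
  have "hconv (deriv F) (D n) z = hconv F (D (Suc n)) z"
    using assms by (intro hconv_by_parts smooth_bump_continuous[OF assms(2)]) (auto simp: smooth_bump_def)
  then show ?thesis
    using hconv_has_field_derivative[OF assms(1) smooth_bump_continuous[OF assms(2)] assms(3), of n] by simp
qed

text \<open>The derivative \<open>G'\<close> of \<open>G = hconv F (D 0)\<close> is bounded near the boundary: \<open>Re G'\<close> is the mollification
  with \<open>D 1\<close>, and the vertical derivative of \<open>Im G'\<close> is \<open>Re G''\<close>, the mollification with \<open>D 2\<close>.\<close>

lemma hconv_bump_lipschitz:
  assumes F: "F holomorphic_on upper_half_plane" and bv: "zero_boundary_Re F" and D: "smooth_bump D"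
  shows "\<exists>M. \<exists>\<delta>>0. M-lipschitz_on {z. \<bar>Re z\<bar> \<le> r \<and> 0 < Im z \<and> Im z < \<delta>} (hconv F (D 0))"
proof -
  let ?G = "\<lambda>n. hconv F (D n)"
  obtain M1 \<delta>1 where 1: "\<delta>1 > 0" "\<And>x y. 0 < y \<Longrightarrow> y < \<delta>1 \<Longrightarrow> \<bar>x\<bar> \<le> r \<Longrightarrow> \<bar>Re (?G 1 (Complex x y))\<bar> \<le> M1"
    using Re_hconv_bounded[OF F bv D, where n = 1 and r = r] by (force simp: abs_le_iff)
  obtain M2 \<delta>2 where 2: "\<delta>2 > 0" "\<And>x y. 0 < y \<Longrightarrow> y < \<delta>2 \<Longrightarrow> \<bar>x\<bar> \<le> r \<Longrightarrow> \<bar>Re (?G 2 (Complex x y))\<bar> \<le> M2"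
    using Re_hconv_bounded[OF F bv D, where n = 2 and r = r] by (force simp: abs_le_iff)
  \<comment> \<open>Strictly below both heights, so both bounds are available up to and including
    height \<open>d\<close>. There \<open>Im (?G 1)\<close> is bounded by compactness, and the
    estimate is carried downwards from that segment.\<close>
  define d where "d = min \<delta>1 \<delta>2 / 2"
  have d: "0 < d" "d < \<delta>1" "d < \<delta>2" using 1 2 by (auto simp: d_def)
  have "continuous_on {-r..r} (\<lambda>x. Im (?G 1 (Complex x d)))"
    unfolding Complex_eq
    by (intro continuous_intros continuous_on_compose2[OF holomorphic_on_imp_continuous_on[OF
          hconv_holomorphic[OF F smooth_bump_continuous[OF D]]]])
      (use d in \<open>auto simp: upper_half_plane_def\<close>)
  then have "bounded ((\<lambda>x. Im (?G 1 (Complex x d))) ` {-r..r})"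
    by (intro compact_imp_bounded compact_continuous_image) auto
  then obtain M3 where M3: "\<And>x. \<bar>x\<bar> \<le> r \<Longrightarrow> \<bar>Im (?G 1 (Complex x d))\<bar> \<le> M3"
    by (force simp: bounded_iff abs_le_iff)
  define M where "M = \<bar>M1\<bar> + \<bar>M3\<bar> + \<bar>M2\<bar> * d"
  let ?S = "{z. \<bar>Re z\<bar> \<le> r \<and> 0 < Im z \<and> Im z < d}"
  have bound: "norm (?G 1 z) \<le> M" if z: "z \<in> ?S" for z
  proof -
    define x y where "x = Re z" and "y = Im z"
    have zxy: "z = Complex x y" by (simp add: x_def y_def)
    have x: "\<bar>x\<bar> \<le> r" and y: "0 < y" "y < d" using z by (auto simp: x_def y_def)
    have "norm (Im (?G 1 (Complex x y)) - Im (?G 1 (Complex x d))) \<le> \<bar>M2\<bar> * norm (y - d)"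
    proof (rule field_differentiable_bound[where S = "{y..d}"])
      fix t assume t: "t \<in> {y..d}"
      then have H: "Complex x t \<in> upper_half_plane" using y by (simp add: upper_half_plane_def)
      have "((\<lambda>t. Complex x t) has_vector_derivative \<i>) (at t within {y..d})"
        unfolding Complex_eq by (auto intro!: derivative_eq_intros)
      moreover have "(?G 1 has_field_derivative ?G 2 (Complex x t)) (at (Complex x t) within Complex x ` {y..d})"
        using has_field_derivative_at_within[OF hconv_bump_has_field_derivative[OF F D H, of 1]]
        by (simp add: numeral_2_eq_2)
      ultimately have "(?G 1 \<circ> Complex x has_vector_derivative \<i> * ?G 2 (Complex x t)) (at t within {y..d})"
        by (rule field_vector_diff_chain_within)
      from bounded_linear.has_vector_derivative[OF bounded_linear_Im this]
      show "((\<lambda>t. Im (?G 1 (Complex x t))) has_field_derivative Re (?G 2 (Complex x t))) (at t within {y..d})"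
        by (simp add: has_real_derivative_iff_has_vector_derivative o_def)
      show "norm (Re (?G 2 (Complex x t))) \<le> \<bar>M2\<bar>"
        using 2(2)[of t x] t x y d by auto
    qed (use y in auto)
    also have "\<dots> \<le> \<bar>M2\<bar> * d" using y by (intro mult_left_mono) auto
    finally have "\<bar>Im (?G 1 z)\<bar> \<le> \<bar>M3\<bar> + \<bar>M2\<bar> * d" using M3[OF x] by (simp add: zxy)
    moreover have "\<bar>Re (?G 1 z)\<bar> \<le> \<bar>M1\<bar>" using 1(2)[of y x] x y d by (simp add: zxy)
    ultimately show ?thesis using cmod_le[of "?G 1 z"] by (simp add: M_def)
  qed
  have "convex ?S"
  proof -
    have "?S = {z. Re z \<le> r} \<inter> {z. Re z \<ge> - r} \<inter> {z. Im z > 0} \<inter> {z. Im z < d}" by (auto simp: abs_le_iff)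
    then show ?thesis
      by (simp add: convex_Int convex_halfspace_Re_le convex_halfspace_Re_ge convex_halfspace_Im_gt convex_halfspace_Im_lt)
  qed
  then have "norm (?G 0 z - ?G 0 w) \<le> M * norm (z - w)" if "z \<in> ?S" "w \<in> ?S" for z w
  proof (rule field_differentiable_bound[where f' = "?G 1"])
    show "(?G 0 has_field_derivative ?G 1 z) (at z within ?S)" if "z \<in> ?S" for z
      using has_field_derivative_at_within[OF hconv_bump_has_field_derivative[OF F D, of z 0]] that
      by (simp add: upper_half_plane_def)
  qed (use bound that in auto)
  then have "M-lipschitz_on ?S (?G 0)"
    using d by (intro lipschitz_onI) (auto simp: dist_norm M_def)
  then show ?thesis using d by blast
qed

text \<open>The Schwarz reflection principle for \<open>\<i> * G\<close>, whose continuous extension is real on the real axis.\<close>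

lemma entire_reflection:
  assumes G: "G holomorphic_on upper_half_plane"
    and lip: "\<And>r. \<exists>M. \<exists>\<delta>>0. M-lipschitz_on {z. \<bar>Re z\<bar> \<le> r \<and> 0 < Im z \<and> Im z < \<delta>} G"
    and lim: "\<And>x. ((\<lambda>y. Re (G (Complex x y))) \<longlongrightarrow> 0) (at_right 0)"
  obtains h where "h holomorphic_on UNIV" "\<And>z. z \<in> upper_half_plane \<Longrightarrow> h z = \<i> * G z"
    "\<And>z. h (cnj z) = cnj (h z)"
proof
  define e where "e n = \<i> * of_real (1 / real (Suc n))" for n
  \<comment> \<open>One formula for interior and boundary values. On the real axis the limit exists
    because the Lipschitz bound transports the Cauchy property of \<open>z + e n\<close>.\<close>
  define f where "f z = lim (\<lambda>n. G (z + e n))" for z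
  have e_lim: "(\<lambda>n. 1 / real (Suc n)) \<longlonglongrightarrow> 0"
    using LIMSEQ_inverse_real_of_nat by (simp add: inverse_eq_divide)
  have e0: "e \<longlonglongrightarrow> 0"
    unfolding e_def by (intro tendsto_mult_right_zero tendsto_of_real[OF e_lim, unfolded of_real_0])
  have Re_e: "Re (e n) = 0" and Im_e: "Im (e n) = 1 / real (Suc n)" for n
    by (auto simp: e_def)
  have Im_e_pos: "0 < Im (e n)" for n by (simp add: Im_e)
  have Im_e_lim: "(\<lambda>n. Im (e n)) \<longlonglongrightarrow> 0" using e_lim by (simp add: Im_e)
  have ze: "(\<lambda>n. z + e n) \<longlonglongrightarrow> z" for z using tendsto_add[OF tendsto_const e0, of z] by simp
  have contG: "continuous_on upper_half_plane G" by (rule holomorphic_on_imp_continuous_on[OF G])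
  have f_eq: "f z = G z" if "z \<in> upper_half_plane" for z
  proof -
    have "isCont G z" using contG open_upper_half_plane that by (simp add: continuous_on_eq_continuous_at)
    then have "(\<lambda>n. G (z + e n)) \<longlonglongrightarrow> G z" using ze by (rule isCont_tendsto_compose)
    then show ?thesis unfolding f_def by (rule limI)
  qed
  have f_lim: "(\<lambda>n. G (z + e n)) \<longlonglongrightarrow> f z" if z: "0 \<le> Im z" for z
  proof (cases "Im z = 0")
    case False
    then have zH: "z \<in> upper_half_plane" using z by (simp add: upper_half_plane_def)
    have "isCont G z" using contG open_upper_half_plane zH by (simp add: continuous_on_eq_continuous_at)
    then show ?thesis unfolding f_eq[OF zH] using ze by (rule isCont_tendsto_compose)
  next
    case True
    obtain M \<delta> where \<delta>: "\<delta> > 0" and L: "M-lipschitz_on {w. \<bar>Re w\<bar> \<le> \<bar>Re z\<bar> \<and> 0 < Im w \<and> Im w < \<delta>} G"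
      using lip by blast
    have "\<forall>\<^sub>F n in sequentially. Im (e n) < \<delta>" using Im_e_lim \<delta> by (rule order_tendstoD(2))
    then obtain n0 where n0: "\<And>n. n \<ge> n0 \<Longrightarrow> Im (e n) < \<delta>" by (auto simp: eventually_sequentially)
    have "Cauchy (\<lambda>n. G (z + e (n + n0)))"
    proof (rule uniformly_continuous_on_Cauchy[OF lipschitz_on_uniformly_continuous[OF L]])
      show "Cauchy (\<lambda>n. z + e (n + n0))"
        using ze by (intro LIMSEQ_imp_Cauchy LIMSEQ_ignore_initial_segment)
      show "z + e (n + n0) \<in> {w. \<bar>Re w\<bar> \<le> \<bar>Re z\<bar> \<and> 0 < Im w \<and> Im w < \<delta>}" for n
        using n0[of "n + n0"] Im_e_pos True by (simp add: Re_e)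
    qed
    then have "convergent (\<lambda>n. G (z + e (n + n0)))" by (rule Cauchy_convergent)
    then have "convergent (\<lambda>n. G (z + e n))"
      by (rule iffD1[OF convergent_ignore_initial_segment[where f = "\<lambda>n. G (z + e n)"]])
    then show ?thesis unfolding f_def by (simp add: convergent_LIMSEQ_iff)
  qed
  have cont: "continuous_on {z. 0 \<le> Im z} f"
    unfolding continuous_on_eq_continuous_within
  proof (intro ballI)
    fix z assume "z \<in> {z. 0 \<le> Im z}"
    then consider "0 < Im z" | "Im z = 0" by force
    then show "continuous (at z within {z. 0 \<le> Im z}) f"
    proof cases
      case 1
      have "continuous_on upper_half_plane f" using contG f_eq by (simp cong: continuous_on_cong)
      then have "isCont f z" using open_upper_half_plane 1
        by (simp add: continuous_on_eq_continuous_at upper_half_plane_def)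
      then show ?thesis by (rule continuous_at_imp_continuous_at_within)
    next
      case 2
      define r where "r = \<bar>Re z\<bar> + 1"
      obtain M \<delta> where \<delta>: "\<delta> > 0" and L: "M-lipschitz_on {w. \<bar>Re w\<bar> \<le> r \<and> 0 < Im w \<and> Im w < \<delta>} G"
        using lip by blast
      let ?S = "{w. \<bar>Re w\<bar> \<le> r \<and> 0 \<le> Im w \<and> Im w < \<delta>}"
      \<comment> \<open>The Lipschitz estimate survives the limit in \<open>n\<close> and then
        includes the edge \<open>Im w = 0\<close>; this gives continuity in all directions, not only
        along verticals.\<close>
      have "M-lipschitz_on ?S f"
      proof (rule lipschitz_onI)
        fix v w assume v: "v \<in> ?S" and w: "w \<in> ?S"
        have lims: "(\<lambda>n. dist (G (v + e n)) (G (w + e n))) \<longlonglongrightarrow> dist (f v) (f w)"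
          using f_lim v w by (intro tendsto_dist) auto
        have "(\<lambda>n. Im v + Im (e n)) \<longlonglongrightarrow> Im v" "(\<lambda>n. Im w + Im (e n)) \<longlonglongrightarrow> Im w"
          using tendsto_add[OF tendsto_const Im_e_lim] by simp_all
        then have "\<forall>\<^sub>F n in sequentially. Im v + Im (e n) < \<delta>" "\<forall>\<^sub>F n in sequentially. Im w + Im (e n) < \<delta>"
          using v w by (auto intro: order_tendstoD(2))
        then have "\<forall>\<^sub>F n in sequentially. dist (G (v + e n)) (G (w + e n)) \<le> M * dist v w"
        proof eventually_elim
          case (elim n)
          then show ?case
            using lipschitz_onD[OF L, of "v + e n" "w + e n"] v w Im_e_pos[of n]
            by (simp add: Re_e add_nonneg_pos)
        qed
        then show "dist (f v) (f w) \<le> M * dist v w"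
          by (intro tendsto_upperbound[OF lims]) auto
      qed (rule lipschitz_on_nonneg[OF L])
      then have "continuous_on ?S f" by (rule lipschitz_on_continuous_on)
      moreover have "z \<in> ?S" using 2 \<delta> by (simp add: r_def)
      ultimately have "continuous (at z within ?S) f" by (simp add: continuous_on_eq_continuous_within)
      moreover have "at z within ?S = at z within {z. 0 \<le> Im z}"
      proof (rule at_within_nhd)
        show "open {w. \<bar>Re w\<bar> < r \<and> Im w < \<delta>}"
          by (intro open_Collect_conj open_Collect_less continuous_intros)
      qed (use 2 \<delta> in \<open>auto simp: r_def\<close>)
      ultimately show ?thesis by simp
    qed
  qed
  have Re_f: "Re (f z) = 0" if "Im z = 0" for z
  proof -
    have "filterlim (\<lambda>n. Im (e n)) (at_right 0) sequentially"
      using Im_e_lim by (rule tendsto_imp_filterlim_at_right) (use Im_e_pos in auto)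
    then have "(\<lambda>n. Re (G (Complex (Re z) (Im (e n))))) \<longlonglongrightarrow> 0" by (rule filterlim_compose[OF lim])
    moreover have "Complex (Re z) (Im (e n)) = z + e n" for n
      using that by (simp add: complex_eq_iff Re_e)
    ultimately have "(\<lambda>n. Re (G (z + e n))) \<longlonglongrightarrow> 0" by simp
    moreover have "(\<lambda>n. Re (G (z + e n))) \<longlonglongrightarrow> Re (f z)" using f_lim that by (intro tendsto_Re) auto
    ultimately show ?thesis using LIMSEQ_unique by blast
  qed
  define h where "h z = (if 0 \<le> Im z then \<i> * f z else cnj (\<i> * f (cnj z)))" for z
  show "h holomorphic_on UNIV"
    unfolding h_def
  proof (rule Schwarz_reflection)
    have "(\<lambda>z. \<i> * G z) holomorphic_on upper_half_plane" using G by (intro holomorphic_intros)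
    then have "(\<lambda>z. \<i> * f z) holomorphic_on upper_half_plane"
      by (rule holomorphic_transform) (simp add: f_eq)
    then show "(\<lambda>z. \<i> * f z) holomorphic_on UNIV \<inter> {z. 0 < Im z}"
      by (simp add: upper_half_plane_def)
    show "continuous_on (UNIV \<inter> {z. 0 \<le> Im z}) (\<lambda>z. \<i> * f z)"
      using cont by (auto intro!: continuous_intros)
    show "\<i> * f z \<in> \<real>" if "z \<in> \<real>" for z
      using Re_f[of z] that by (simp add: complex_is_Real_iff)
  qed auto
  show "h z = \<i> * G z" if "z \<in> upper_half_plane" for z
    using that f_eq[OF that] by (simp add: h_def upper_half_plane_def)
  show "h (cnj z) = cnj (h z)" for z
  proof (cases "Im z = 0")
    case True
    then have "cnj z = z" by (simp add: complex_eq_iff)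
    moreover have "cnj (h z) = h z" using True Re_f[OF True] by (simp add: h_def complex_eq_iff)
    ultimately show ?thesis by simp
  qed (auto simp: h_def)
qed

section \<open>Entire functions of temperate growth\<close>

text \<open>With \<open>k = - \<i> * (h - h z)\<close>, the quotient \<open>k / (4 * m - k)\<close> is bounded by 1 since \<open>Re k \<le> 2 * m\<close>;
  Cauchy's inequality applies to it.\<close>

lemma deriv_bound_by_Im:
  assumes h: "h holomorphic_on cball z r" and r: "0 < r" and m: "0 < m"
    and bd: "\<And>w. w \<in> cball z r \<Longrightarrow> \<bar>Im (h w)\<bar> \<le> m"
  shows "norm (deriv h z) \<le> 4 * m / r"
proof -
  define k where "k w = - \<i> * (h w - h z)" for w
  define q where "q w = k w / (of_real (4 * m) - k w)" for w
  have Rek: "Re (k w) \<le> 2 * m" if "w \<in> cball z r" for w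
    using bd[OF that] bd[of z] r by (simp add: k_def)
  have ne: "of_real (4 * m) - k w \<noteq> 0" if "w \<in> cball z r" for w
    using Rek[OF that] m by (auto simp: complex_eq_iff)
  have q_le: "norm (q w) \<le> 1" if "w \<in> cball z r" for w
  proof -
    \<comment> \<open>The squares differ by \<open>16 * m\<^sup>2 - 8 * m * Re (k w)\<close>, which
      is nonnegative because \<open>Re (k w) \<le> 2 * m\<close>.\<close>
    have "norm (k w) \<le> norm (of_real (4 * m) - k w)"
    proof (rule power2_le_imp_le)
      have "m * Re (k w) \<le> m * (2 * m)" using Rek[OF that] m by (intro mult_left_mono) auto
      then show "(norm (k w))\<^sup>2 \<le> (norm (of_real (4 * m) - k w))\<^sup>2"
        unfolding cmod_power2 by (simp add: power2_eq_square algebra_simps)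
    qed auto
    then show ?thesis using ne[OF that] by (simp add: q_def norm_divide divide_simps)
  qed
  have hk: "k holomorphic_on cball z r" unfolding k_def by (intro holomorphic_intros h)
  have hq: "q holomorphic_on cball z r"
    unfolding q_def by (intro holomorphic_intros hk ne)
  have "norm ((deriv ^^ 1) q z) \<le> fact 1 * 1 / r ^ 1"
    by (rule Cauchy_inequality)
      (use hq r q_le in \<open>auto intro: holomorphic_on_subset holomorphic_on_imp_continuous_on
         simp: dist_norm\<close>)
  then have dq: "norm (deriv q z) \<le> 1 / r" by simp
  have "h field_differentiable at z"
    by (rule holomorphic_on_imp_differentiable_at[of _ "ball z r"])
       (use h r in \<open>auto intro: holomorphic_on_subset\<close>)
  then have dh: "(h has_field_derivative deriv h z) (at z)"
    by (rule field_differentiable_derivI)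
  have k0: "k z = 0" by (simp add: k_def)
  have dk: "(k has_field_derivative - \<i> * deriv h z) (at z)"
    unfolding k_def by (rule derivative_eq_intros dh refl | simp)+
  have "(q has_field_derivative
      ((- \<i> * deriv h z) * (of_real (4 * m) - k z) - k z * (0 - (- \<i> * deriv h z))) /
      ((of_real (4 * m) - k z) * (of_real (4 * m) - k z))) (at z)"
    unfolding q_def by (rule DERIV_divide DERIV_diff DERIV_const dk)+ (use k0 m in auto)
  \<comment> \<open>\<open>k z = 0\<close> removes the second term of the quotient rule and leaves
    the factor \<open>1 / (4 * m)\<close>.\<close>
  then have "deriv q z = - \<i> * deriv h z / of_real (4 * m)"
    using m by (simp add: k0 DERIV_imp_deriv field_simps)
  then have "norm (deriv h z) = 4 * m * norm (deriv q z)"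
    using m by (simp add: norm_divide norm_mult)
  also have "\<dots> \<le> 4 * m * (1 / r)" using dq m by (intro mult_left_mono) auto
  finally show ?thesis by simp
qed

text \<open>The singular bound near the real axis is absorbed by the factor \<open>(z\<^sup>2 - \<rho>\<^sup>2) ^ (N + 1)\<close>, whose modulus is
  \<open>(2 * \<rho> * \<bar>Im z\<bar>) ^ (N + 1)\<close> on the circle \<open>norm z = \<rho>\<close>. The maximum principle then bounds \<open>deriv h\<close>
  polynomially on the disc of radius \<open>\<rho> / 2\<close>. The order \<open>3 * N + 3\<close> depends on \<open>N\<close> only, so that it is
  the same for all mollifications of one function.\<close>

lemma entire_temperate_Im_imp_higher_deriv_0:
  fixes N :: nat
  assumes h: "h holomorphic_on UNIV" and C: "0 < C" and R: "1 \<le> R"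
    and bd: "\<And>z. R < norm z \<Longrightarrow> Im z \<noteq> 0 \<Longrightarrow> \<bar>Im (h z)\<bar> \<le> C * ((norm z)\<^sup>2 / \<bar>Im z\<bar>) ^ N"
  shows "(deriv ^^ (3 * N + 3)) h z = 0"
proof -
  \<comment> \<open>Collects \<open>8\<close> from \<open>4 * m / (y / 2)\<close>,
    \<open>(9/2) ^ N\<close> from \<open>m\<close>, and \<open>2 ^ (N + 1)\<close> from the modulus
    of the absorbing factor.\<close>
  define C1 where "C1 = 8 * C * (9/2) ^ N * 2 ^ (N + 1)"
  have C1: "C1 > 0" using C by (simp add: C1_def)
  have hd: "deriv h holomorphic_on UNIV" using h by (intro holomorphic_intros) auto
  have d1: "norm (deriv h z * (z\<^sup>2 - (of_real \<rho>)\<^sup>2) ^ (N + 1)) \<le> C1 * \<rho> ^ (3 * N + 1)"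
    if z: "norm z = \<rho>" and \<rho>: "\<rho> > 2 * R" for z \<rho>
  proof (cases "Im z = 0")
    case True
    then have "z\<^sup>2 = (of_real \<rho>)\<^sup>2"
      using complex_norm_square[of z] complex_is_Real_iff[of z] z
      by (simp add: Reals_cnj_iff power2_eq_square)
    then show ?thesis using C1 \<rho> R by simp
  next
    case False
    define y where "y = \<bar>Im z\<bar>"
    have y: "y > 0" "y \<le> \<rho>" using False z abs_Im_le_cmod[of z] by (auto simp: y_def)
    \<comment> \<open>On the disc of radius \<open>y / 2\<close> about \<open>z\<close>,
      \<open>norm w \<le> 3/2 * \<rho>\<close> and \<open>\<bar>Im w\<bar> \<ge> y / 2\<close>, so
      the temperate quotient is at most \<open>9/2 * \<rho>\<^sup>2 / y\<close>.\<close>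
    define m where "m = C * (9/2 * \<rho>\<^sup>2 / y) ^ N"
    have m: "m > 0" using C y \<rho> R by (simp add: m_def)
    have "norm (deriv h z) \<le> 4 * m / (y / 2)"
    proof (rule deriv_bound_by_Im)
      show "h holomorphic_on cball z (y/2)" using h by (rule holomorphic_on_subset) auto
      fix w assume "w \<in> cball z (y / 2)"
      then have d: "norm (z - w) \<le> y / 2" by (simp add: dist_norm)
      have wl: "norm w \<ge> \<rho> / 2" using d z y norm_triangle_ineq2[of z w] by linarith
      have wu: "norm w \<le> 3/2 * \<rho>" using d z y norm_triangle_ineq2[of w z] norm_minus_commute[of z w] by linarith
      have wi: "\<bar>Im w\<bar> \<ge> y / 2" using d abs_Im_le_cmod[of "z - w"] y_def by auto
      have "\<bar>Im (h w)\<bar> \<le> C * ((norm w)\<^sup>2 / \<bar>Im w\<bar>) ^ N"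
        using bd[of w] wl \<rho> wi y by auto
      moreover have "(norm w)\<^sup>2 \<le> 9/4 * \<rho>\<^sup>2" using power_mono[OF wu, of 2] by (simp add: power_mult_distrib power2_eq_square)
      then have "(norm w)\<^sup>2 / \<bar>Im w\<bar> \<le> (9/4 * \<rho>\<^sup>2) / (y / 2)"
        using wi y by (intro frac_le) auto
      then have "C * ((norm w)\<^sup>2 / \<bar>Im w\<bar>) ^ N \<le> m"
        unfolding m_def using C by (intro mult_left_mono power_mono) (auto simp: field_simps)
      ultimately show "\<bar>Im (h w)\<bar> \<le> m" by linarith
    qed (use y m in auto)
    then have dh: "norm (deriv h z) \<le> 8 * m / y" by simp
    \<comment> \<open>On the circle \<open>\<rho>\<^sup>2 = z * cnj z\<close>, which exhibits a
      factor \<open>Im z\<close>. The power \<open>N + 1\<close> instead of \<open>N\<close> absorbs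
      the extra \<open>1 / y\<close> of the derivative bound.\<close>
    have "z * cnj z = (of_real \<rho>)\<^sup>2" using complex_norm_square[of z] z by simp
    then have "z\<^sup>2 - (of_real \<rho>)\<^sup>2 = z * (z - cnj z)" by (simp add: power2_eq_square algebra_simps)
    also have "z - cnj z = of_real (2 * Im z) * \<i>" by (simp add: complex_eq_iff)
    finally have nz: "norm (z\<^sup>2 - (of_real \<rho>)\<^sup>2) = 2 * \<rho> * y"
      using z by (simp add: norm_mult y_def)
    have "norm (deriv h z * (z\<^sup>2 - (of_real \<rho>)\<^sup>2) ^ (N + 1)) \<le> (8 * m / y) * (2 * \<rho> * y) ^ (N + 1)"
      unfolding norm_mult norm_power nz using dh y \<rho> R by (intro mult_right_mono) auto
    also have "\<dots> = C1 * ((\<rho>\<^sup>2) ^ N * \<rho> ^ (N + 1)) * (y ^ (N + 1) / (y * y ^ N))"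
      by (simp add: m_def C1_def power_mult_distrib power_divide mult_ac del: power_Suc)
    also have "(\<rho>\<^sup>2) ^ N * \<rho> ^ (N + 1) = \<rho> ^ (3 * N + 1)"
      by (simp flip: power_mult power_add)
    also have "y ^ (N + 1) / (y * y ^ N) = 1" using y by simp
    finally have "norm (deriv h z * (z\<^sup>2 - (of_real \<rho>)\<^sup>2) ^ (N + 1)) \<le> C1 * \<rho> ^ (3 * N + 1) * 1" .
    then show ?thesis by simp
  qed
  have d2: "norm (deriv h z) \<le> C1 * 2 ^ (N + 1) * \<rho> ^ (3 * N + 1)"
    if z: "norm z \<le> \<rho> / 2" and \<rho>: "\<rho> > 2 * R" for z \<rho>
  proof -
    have le: "norm (deriv h z * (z\<^sup>2 - (of_real \<rho>)\<^sup>2) ^ (N + 1)) \<le> C1 * \<rho> ^ (3 * N + 1)"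
    proof (rule maximum_modulus_frontier[where S = "cball 0 \<rho>" and f = "\<lambda>z. deriv h z * (z\<^sup>2 - (of_real \<rho>)\<^sup>2) ^ (N + 1)"])
      have hol: "(\<lambda>z. deriv h z * (z\<^sup>2 - (of_real \<rho>)\<^sup>2) ^ (N + 1)) holomorphic_on UNIV"
        by (intro holomorphic_intros hd)
      show "(\<lambda>z. deriv h z * (z\<^sup>2 - (of_real \<rho>)\<^sup>2) ^ (N + 1)) holomorphic_on interior (cball 0 \<rho>)"
        using hol by (rule holomorphic_on_subset) auto
      show "continuous_on (closure (cball 0 \<rho>)) (\<lambda>z. deriv h z * (z\<^sup>2 - (of_real \<rho>)\<^sup>2) ^ (N + 1))"
        using holomorphic_on_imp_continuous_on[OF hol] by (rule continuous_on_subset) auto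
      fix w :: complex assume "w \<in> frontier (cball 0 \<rho>)"
      then have "norm w = \<rho>" using \<rho> R by (simp add: frontier_cball)
      then show "norm (deriv h w * (w\<^sup>2 - (of_real \<rho>)\<^sup>2) ^ (N + 1)) \<le> C1 * \<rho> ^ (3 * N + 1)"
        by (rule d1[OF _ \<rho>])
    qed (use z \<rho> R in auto)
    have "(norm z)\<^sup>2 \<le> (\<rho> / 2)\<^sup>2" using z by (intro power_mono) auto
    then have "norm (z\<^sup>2) \<le> \<rho>\<^sup>2 / 4" by (simp add: norm_power power_divide)
    moreover have "norm ((of_real \<rho>)\<^sup>2 :: complex) = \<rho>\<^sup>2" by (simp add: norm_power)
    moreover have "norm ((of_real \<rho>)\<^sup>2 :: complex) - norm (z\<^sup>2) \<le> norm (z\<^sup>2 - (of_real \<rho>)\<^sup>2)"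
      using norm_triangle_ineq2[of "(of_real \<rho>)\<^sup>2" "z\<^sup>2"] by (simp add: norm_minus_commute)
    moreover have "0 \<le> \<rho>\<^sup>2" by simp
    ultimately have "\<rho>\<^sup>2 / 2 \<le> norm (z\<^sup>2 - (of_real \<rho>)\<^sup>2)" by linarith
    moreover have "1 \<le> \<rho>\<^sup>2" using \<rho> R by (intro one_le_power) auto
    \<comment> \<open>A constant lower bound on the inner disc: removing the absorbing factor costs
      \<open>2 ^ (N + 1)\<close> and keeps the exponent \<open>3 * N + 1\<close>.\<close>
    ultimately have "1 / 2 \<le> norm (z\<^sup>2 - (of_real \<rho>)\<^sup>2)" by linarith
    then have "(1 / 2) ^ (N + 1) \<le> norm (z\<^sup>2 - (of_real \<rho>)\<^sup>2) ^ (N + 1)" by (intro power_mono) auto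
    then have "norm (deriv h z) * (1 / 2) ^ (N + 1) \<le> norm (deriv h z * (z\<^sup>2 - (of_real \<rho>)\<^sup>2) ^ (N + 1))"
      unfolding norm_mult norm_power by (intro mult_left_mono) auto
    then have "norm (deriv h z) * (1 / 2) ^ (N + 1) \<le> C1 * \<rho> ^ (3 * N + 1)" using le by linarith
    then show ?thesis by (simp add: field_simps power_divide)
  qed
  \<comment> \<open>One above the growth exponent \<open>3 * N + 1\<close> of
    \<open>deriv h\<close>, so that Cauchy's estimate decays like \<open>1 / \<rho>\<close>; counted
    from \<open>h\<close> the order is \<open>3 * N + 3\<close>.\<close>
  let ?n = "3 * N + 2"
  let ?K = "fact ?n * (C1 * 2 ^ (N + 1)) * 4 ^ ?n"
  have d3: "norm ((deriv ^^ ?n) (deriv h) z) \<le> ?K / \<rho>" if \<rho>: "\<rho> > 2 * R" "norm z < \<rho> / 4" for \<rho>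
  proof -
    have "norm ((deriv ^^ ?n) (deriv h) z) \<le> fact ?n * (C1 * 2 ^ (N + 1) * \<rho> ^ (3 * N + 1)) / (\<rho> / 4) ^ ?n"
    proof (rule Cauchy_inequality)
      show "deriv h holomorphic_on ball z (\<rho> / 4)" using hd by (rule holomorphic_on_subset) auto
      show "continuous_on (cball z (\<rho> / 4)) (deriv h)"
        using holomorphic_on_imp_continuous_on[OF hd] by (rule continuous_on_subset) auto
      show "0 < \<rho> / 4" using \<rho> R by simp
      fix w assume "norm (z - w) = \<rho> / 4"
      then have "norm w \<le> \<rho> / 2" using \<rho> norm_triangle_ineq2[of w z] norm_minus_commute[of z w] by linarith
      then show "norm (deriv h w) \<le> C1 * 2 ^ (N + 1) * \<rho> ^ (3 * N + 1)" by (rule d2[OF _ \<rho>(1)])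
    qed
    also have "\<dots> = ?K / \<rho>" using \<rho> R by (simp add: power_divide field_simps)
    finally show ?thesis .
  qed
  have "((\<lambda>\<rho>. ?K / \<rho>) \<longlongrightarrow> 0) at_top"
    by (intro tendsto_divide_0[OF tendsto_const] filterlim_at_top_imp_at_infinity filterlim_ident)
  moreover have "\<forall>\<^sub>F \<rho> in at_top. norm ((deriv ^^ ?n) (deriv h) z) \<le> ?K / \<rho>"
    using eventually_gt_at_top[of "2 * R"] eventually_gt_at_top[of "4 * norm z"]
    by eventually_elim (rule d3, auto)
  ultimately have "norm ((deriv ^^ ?n) (deriv h) z) \<le> 0"
    by (intro tendsto_lowerbound) auto
  moreover have "(deriv ^^ ?n) (deriv h) = (deriv ^^ (3 * N + 3)) h"
    unfolding funpow_simps_right(2)[of ?n deriv, THEN fun_cong, unfolded o_def, symmetric]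
    by (simp add: numeral_3_eq_3)
  ultimately show ?thesis by simp
qed

section \<open>Harmonic functions as real parts of holomorphic functions\<close>

text \<open>Naming the partials \<open>gx\<close> and \<open>gy\<close> lets second partials be
  expressed by applying the predicate again to them.\<close>

definition has_partials_on ::
    "(complex \<Rightarrow> real) \<Rightarrow> (complex \<Rightarrow> real) \<Rightarrow> (complex \<Rightarrow> real) \<Rightarrow> complex set \<Rightarrow> bool" where
  "has_partials_on g gx gy S \<longleftrightarrow> continuous_on S gx \<and> continuous_on S gy \<and>
     (\<forall>z\<in>S. ((\<lambda>t. g (z + of_real t)) has_real_derivative gx z) (at 0) \<and>
            ((\<lambda>t. g (z + of_real t * \<i>)) has_real_derivative gy z) (at 0))"

lemma has_partials_on_horizontal:
  assumes "has_partials_on g gx gy S" "w + of_real s \<in> S"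
  shows "((\<lambda>t. g (w + of_real t)) has_real_derivative gx (w + of_real s)) (at s within T)"
proof -
  have "((\<lambda>t. g ((w + of_real s) + of_real t)) has_real_derivative gx (w + of_real s)) (at 0)"
    using assms by (simp add: has_partials_on_def)
  then have "((\<lambda>t. g (w + of_real (t + s))) has_real_derivative gx (w + of_real s)) (at 0)"
    by (simp add: add_ac)
  then have "((\<lambda>t. g (w + of_real t)) has_real_derivative gx (w + of_real s)) (at (0 + s))"
    by (subst DERIV_shift)
  then show ?thesis by (simp add: has_field_derivative_at_within)
qed

lemma has_partials_on_vertical:
  assumes "has_partials_on g gx gy S" "w + of_real s * \<i> \<in> S"
  shows "((\<lambda>t. g (w + of_real t * \<i>)) has_real_derivative gy (w + of_real s * \<i>)) (at s within T)"
proof -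
  have "((\<lambda>t. g ((w + of_real s * \<i>) + of_real t * \<i>)) has_real_derivative gy (w + of_real s * \<i>)) (at 0)"
    using assms by (simp add: has_partials_on_def)
  then have "((\<lambda>t. g (w + of_real (t + s) * \<i>)) has_real_derivative gy (w + of_real s * \<i>)) (at 0)"
    by (simp add: algebra_simps)
  then have "((\<lambda>t. g (w + of_real t * \<i>)) has_real_derivative gy (w + of_real s * \<i>)) (at (0 + s))"
    by (subst DERIV_shift)
  then show ?thesis by (simp add: has_field_derivative_at_within)
qed

text \<open>Move from \<open>z\<close> horizontally and then vertically; by continuity of the
  partials, the mean value inequality gives an error of at most \<open>\<epsilon> / 2\<close> times
  the length of each leg.\<close>

lemma has_partials_on_has_derivative:
  assumes g: "has_partials_on g gx gy S" and S: "open S" "z \<in> S"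
  shows "(g has_derivative (\<lambda>h. Re h * gx z + Im h * gy z)) (at z)"
  unfolding has_derivative_at_alt
proof (intro conjI allI impI)
  show "bounded_linear (\<lambda>h. Re h * gx z + Im h * gy z)"
    by (intro bounded_linear_add bounded_linear_mult_const bounded_linear_Re bounded_linear_Im)
  fix \<epsilon> :: real assume \<epsilon>: "0 < \<epsilon>"
  have "isCont gx z" "isCont gy z"
    using g S by (auto simp: has_partials_on_def continuous_on_eq_continuous_at)
  then have "\<forall>e>0. \<exists>d>0. \<forall>w. dist w z < d \<longrightarrow> dist (gx w) (gx z) < e"
    "\<forall>e>0. \<exists>d>0. \<forall>w. dist w z < d \<longrightarrow> dist (gy w) (gy z) < e"
    unfolding continuous_at_eps_delta dist_norm by blast+
  from this[THEN spec, of "\<epsilon> / 2"] obtain d1 d2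
    where d1: "d1 > 0" "\<And>w. dist w z < d1 \<Longrightarrow> dist (gx w) (gx z) < \<epsilon> / 2"
      and d2: "d2 > 0" "\<And>w. dist w z < d2 \<Longrightarrow> dist (gy w) (gy z) < \<epsilon> / 2"
    using \<epsilon> by auto
  obtain d3 where d3: "d3 > 0" "ball z d3 \<subseteq> S" using S open_contains_ball by blast
  define d where "d = Min {d1, d2, d3}"
  have d: "d > 0" "d \<le> d1" "d \<le> d2" "d \<le> d3" using d1 d2 d3 by (auto simp: d_def)
  have "norm (g w - g z - (Re (w - z) * gx z + Im (w - z) * gy z)) \<le> \<epsilon> * norm (w - z)"
    if w: "norm (w - z) < d" for w
  proof -
    define a b where "a = Re (w - z)" and "b = Im (w - z)"
    have ab: "\<bar>a\<bar> \<le> norm (w - z)" "\<bar>b\<bar> \<le> norm (w - z)"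
      by (simp_all only: a_def b_def abs_Re_le_cmod abs_Im_le_cmod)
    have w_eq: "w = (z + of_real a) + of_real b * \<i>" by (simp add: complex_eq_iff a_def b_def)
    have near1: "dist (z + of_real t) z < d" if "t \<in> closed_segment 0 a" for t
      using that ab w by (auto simp: closed_segment_eq_real_ivl dist_norm split: if_splits)
    have near2: "dist ((z + of_real a) + of_real t * \<i>) z < d" if "t \<in> closed_segment 0 b" for t
    proof -
      have t: "\<bar>t\<bar> \<le> \<bar>b\<bar>" using that by (auto simp: closed_segment_eq_real_ivl split: if_splits)
      have "dist ((z + of_real a) + of_real t * \<i>) z = sqrt (a\<^sup>2 + t\<^sup>2)"
        by (simp add: dist_norm cmod_def)
      also have "\<dots> \<le> sqrt (a\<^sup>2 + b\<^sup>2)" using t by (simp add: abs_le_square_iff)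
      also have "\<dots> = norm (w - z)" by (simp add: cmod_def a_def b_def)
      finally show ?thesis using w by simp
    qed
    have "norm ((g (z + of_real a) - a * gx z) - (g (z + of_real 0) - 0 * gx z)) \<le> \<epsilon> / 2 * norm (a - 0)"
    proof (rule field_differentiable_bound[where S = "closed_segment 0 a"
            and f = "\<lambda>t. g (z + of_real t) - t * gx z" and f' = "\<lambda>t. gx (z + of_real t) - gx z"])
      fix t assume t: "t \<in> closed_segment 0 a"
      have "z + of_real t \<in> S" using near1[OF t] d d3 by (auto simp: dist_commute)
      from has_partials_on_horizontal[OF g this]
      show "((\<lambda>t. g (z + of_real t) - t * gx z) has_field_derivative gx (z + of_real t) - gx z)
          (at t within closed_segment 0 a)"
        by (auto intro!: derivative_eq_intros)
      show "norm (gx (z + of_real t) - gx z) \<le> \<epsilon> / 2"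
        using d1(2)[of "z + of_real t"] near1[OF t] d by (simp add: dist_norm)
    qed auto
    moreover have "norm ((g ((z + of_real a) + of_real b * \<i>) - b * gy z) - (g ((z + of_real a) + of_real 0 * \<i>) - 0 * gy z))
        \<le> \<epsilon> / 2 * norm (b - 0)"
    proof (rule field_differentiable_bound[where S = "closed_segment 0 b"
            and f = "\<lambda>t. g ((z + of_real a) + of_real t * \<i>) - t * gy z"
            and f' = "\<lambda>t. gy ((z + of_real a) + of_real t * \<i>) - gy z"])
      fix t assume t: "t \<in> closed_segment 0 b"
      have "(z + of_real a) + of_real t * \<i> \<in> S" using near2[OF t] d d3 by (auto simp: dist_commute)
      from has_partials_on_vertical[OF g this]
      show "((\<lambda>t. g ((z + of_real a) + of_real t * \<i>) - t * gy z) has_field_derivative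
          gy ((z + of_real a) + of_real t * \<i>) - gy z) (at t within closed_segment 0 b)"
        by (auto intro!: derivative_eq_intros)
      show "norm (gy ((z + of_real a) + of_real t * \<i>) - gy z) \<le> \<epsilon> / 2"
        using d2(2)[of "(z + of_real a) + of_real t * \<i>"] near2[OF t] d by (simp add: dist_norm)
    qed auto
    ultimately have "\<bar>g (z + of_real a) - a * gx z - g z\<bar> \<le> \<epsilon> / 2 * \<bar>a\<bar>"
      "\<bar>g w - b * gy z - g (z + of_real a)\<bar> \<le> \<epsilon> / 2 * \<bar>b\<bar>"
      by (simp_all add: w_eq)
    moreover have "\<epsilon> / 2 * \<bar>a\<bar> \<le> \<epsilon> / 2 * norm (w - z)" "\<epsilon> / 2 * \<bar>b\<bar> \<le> \<epsilon> / 2 * norm (w - z)"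
      using ab \<epsilon> by (auto intro!: mult_left_mono)
    ultimately have "\<bar>g w - g z - (a * gx z + b * gy z)\<bar> \<le> \<epsilon> / 2 * norm (w - z) + \<epsilon> / 2 * norm (w - z)"
      by linarith
    then show ?thesis by (simp add: a_def b_def)
  qed
  then show "\<exists>d>0. \<forall>w. norm (w - z) < d \<longrightarrow>
      norm (g w - g z - (Re (w - z) * gx z + Im (w - z) * gy z)) \<le> \<epsilon> * norm (w - z)"
    using d by blast
qed

text \<open>The second difference of \<open>v\<close> over a square of side \<open>h\<close> is
  \<open>h\<^sup>2\<close> times a value of \<open>py\<close>, and also \<open>h\<^sup>2\<close>
  times a value of \<open>qx\<close>, at points inside the square; then \<open>h\<close> tends to 0.
  The square extends upwards from \<open>z\<close> and so lies in the half-plane for every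
  \<open>h > 0\<close>.\<close>

lemma mixed_partials_upper_half_plane:
  assumes v: "has_partials_on v p q upper_half_plane"
    and p: "has_partials_on p px py upper_half_plane" and q: "has_partials_on q qx qy upper_half_plane"
    and z: "z \<in> upper_half_plane"
  shows "py z = qx z"
proof -
  have "\<exists>s t s' t'. 0 < s \<and> s < h \<and> 0 < t \<and> t < h \<and> 0 < s' \<and> s' < h \<and> 0 < t' \<and> t' < h \<and>
      py (z + of_real s + of_real t * \<i>) = qx (z + of_real s' + of_real t' * \<i>)" if h: "0 < h" for h
  proof -
    let ?A = "\<lambda>s. v ((z + of_real h * \<i>) + of_real s) - v (z + of_real s)"
    let ?B = "\<lambda>t. v ((z + of_real h) + of_real t * \<i>) - v (z + of_real t * \<i>)"
    have memH: "z + of_real x + of_real y * \<i> \<in> upper_half_plane" "z + of_real y * \<i> + of_real x \<in> upper_half_plane"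
      if "0 \<le> y" for x y
      using z that by (auto simp: upper_half_plane_def)
    have memH0: "z + of_real x \<in> upper_half_plane" "0 \<le> y \<Longrightarrow> z + of_real y * \<i> \<in> upper_half_plane" for x y
      using z by (auto simp: upper_half_plane_def)
    have "(?A has_real_derivative p (z + of_real h * \<i> + of_real s) - p (z + of_real s)) (at s)" for s
      using h by (intro DERIV_diff has_partials_on_horizontal[OF v] memH memH0) simp
    from MVT2[OF h this] obtain s where s: "0 < s" "s < h"
      "?A h - ?A 0 = (h - 0) * (p (z + of_real h * \<i> + of_real s) - p (z + of_real s))"
      by blast
    have "((\<lambda>t. p (z + of_real s + of_real t * \<i>)) has_real_derivative py (z + of_real s + of_real t * \<i>)) (at t)"
      if "0 \<le> t" for t
      using that by (intro has_partials_on_vertical[OF p] memH)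
    from MVT2[OF h this] obtain t where t: "0 < t" "t < h"
      "p (z + of_real s + of_real h * \<i>) - p (z + of_real s + of_real 0 * \<i>) =
        (h - 0) * py (z + of_real s + of_real t * \<i>)"
      by blast
    have "(?B has_real_derivative q (z + of_real h + of_real t * \<i>) - q (z + of_real t * \<i>)) (at t)"
      if "0 \<le> t" for t
      using that by (intro DERIV_diff has_partials_on_vertical[OF v] memH memH0)
    from MVT2[OF h this] obtain t' where t': "0 < t'" "t' < h"
      "?B h - ?B 0 = (h - 0) * (q (z + of_real h + of_real t' * \<i>) - q (z + of_real t' * \<i>))"
      by blast
    have "((\<lambda>s. q (z + of_real t' * \<i> + of_real s)) has_real_derivative qx (z + of_real t' * \<i> + of_real s)) (at s)" for s
      using t' by (intro has_partials_on_horizontal[OF q] memH) simp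
    from MVT2[OF h this] obtain s' where s': "0 < s'" "s' < h"
      "q (z + of_real t' * \<i> + of_real h) - q (z + of_real t' * \<i> + of_real 0) =
        (h - 0) * qx (z + of_real t' * \<i> + of_real s')"
      by blast
    have "?A h - ?A 0 = ?B h - ?B 0" by (simp add: algebra_simps)
    moreover have "?A h - ?A 0 = h * (h * py (z + of_real s + of_real t * \<i>))"
      using s(3) t(3) by (simp add: add_ac)
    moreover have "?B h - ?B 0 = h * (h * qx (z + of_real s' + of_real t' * \<i>))"
      using s'(3) t'(3) by (simp add: add_ac)
    ultimately have "h * (h * py (z + of_real s + of_real t * \<i>)) = h * (h * qx (z + of_real s' + of_real t' * \<i>))"
      by linarith
    then have "py (z + of_real s + of_real t * \<i>) = qx (z + of_real s' + of_real t' * \<i>)"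
      using h by simp
    then show ?thesis using s t s' t' by blast
  qed
  from this[of "1 / real (Suc n)" for n] obtain s t s' t' where
    st: "\<And>n. 0 < s n" "\<And>n. s n < 1 / real (Suc n)" "\<And>n. 0 < t n" "\<And>n. t n < 1 / real (Suc n)"
      "\<And>n. 0 < s' n" "\<And>n. s' n < 1 / real (Suc n)" "\<And>n. 0 < t' n" "\<And>n. t' n < 1 / real (Suc n)"
    and eq: "\<And>n. py (z + of_real (s n) + of_real (t n) * \<i>) = qx (z + of_real (s' n) + of_real (t' n) * \<i>)"
    by (metis of_nat_0_less_iff zero_less_Suc zero_less_divide_1_iff)
  have l0: "(\<lambda>n. 1 / real (Suc n)) \<longlonglongrightarrow> 0"
    using LIMSEQ_inverse_real_of_nat by (simp add: inverse_eq_divide)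
  have lim0: "a \<longlonglongrightarrow> 0" if "\<And>n. 0 < a n" "\<And>n. a n < 1 / real (Suc n)" for a
    by (rule tendsto_sandwich[OF _ _ tendsto_const l0]) (use that in \<open>auto intro!: always_eventually less_imp_le\<close>)
  have limz: "(\<lambda>n. z + of_real (a n) + of_real (b n) * \<i>) \<longlonglongrightarrow> z" if "a \<longlonglongrightarrow> 0" "b \<longlonglongrightarrow> 0" for a b
    using tendsto_add[OF tendsto_add[OF tendsto_const tendsto_of_real[OF that(1)]]
        tendsto_mult[OF tendsto_of_real[OF that(2)] tendsto_const], of z \<i>] by simp
  have cpy: "isCont py z" and cqx: "isCont qx z"
    using p q z open_upper_half_plane by (auto simp: has_partials_on_def continuous_on_eq_continuous_at)
  have "(\<lambda>n. py (z + of_real (s n) + of_real (t n) * \<i>)) \<longlonglongrightarrow> py z"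
    by (rule isCont_tendsto_compose[OF cpy limz[OF lim0[OF st(1,2)] lim0[OF st(3,4)]]])
  moreover have "(\<lambda>n. qx (z + of_real (s' n) + of_real (t' n) * \<i>)) \<longlonglongrightarrow> qx z"
    by (rule isCont_tendsto_compose[OF cqx limz[OF lim0[OF st(5,6)] lim0[OF st(7,8)]]])
  ultimately show ?thesis unfolding eq by (rule LIMSEQ_unique)
qed

text \<open>\<open>p - \<i> * q\<close> satisfies the Cauchy-Riemann equations by harmonicity and
  symmetry of the mixed partials. The real part of its primitive has the gradient of
  \<open>v\<close>, so it differs from \<open>v\<close> by a constant.\<close>

lemma harmonic_partials_imp_Re_holomorphic:
  assumes v: "has_partials_on v p q upper_half_plane"
    and p: "has_partials_on p px py upper_half_plane" and q: "has_partials_on q qx qy upper_half_plane"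
    and lap: "\<And>z. z \<in> upper_half_plane \<Longrightarrow> px z + qy z = 0"
  obtains F where "F holomorphic_on upper_half_plane" "\<And>z. z \<in> upper_half_plane \<Longrightarrow> Re (F z) = v z"
proof -
  define f where "f z = of_real (p z) - \<i> * of_real (q z)" for z
  have "(f has_field_derivative (of_real (px z) - \<i> * of_real (qx z))) (at z)" if z: "z \<in> upper_half_plane" for z
  proof -
    have "(f has_derivative (\<lambda>h. of_real (Re h * px z + Im h * py z) - \<i> * of_real (Re h * qx z + Im h * qy z))) (at z)"
      unfolding f_def
      by (intro has_derivative_diff has_derivative_of_real has_derivative_mult_right
          has_partials_on_has_derivative[OF p open_upper_half_plane z] has_partials_on_has_derivative[OF q open_upper_half_plane z])
    moreover have "(\<lambda>h. of_real (Re h * px z + Im h * py z) - \<i> * of_real (Re h * qx z + Im h * qy z)) =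
        (*) (of_real (px z) - \<i> * of_real (qx z))"
    proof
      have "qy z = - px z" using lap[OF z] by simp
      then show "of_real (Re h * px z + Im h * py z) - \<i> * of_real (Re h * qx z + Im h * qy z) =
          (of_real (px z) - \<i> * of_real (qx z)) * h" for h
        by (simp add: complex_eq_iff mixed_partials_upper_half_plane[OF v p q z] algebra_simps)
    qed
    ultimately show ?thesis by (simp add: has_field_derivative_def)
  qed
  then have "f holomorphic_on upper_half_plane" using open_upper_half_plane by (auto simp: holomorphic_on_open)
  then obtain g where g: "\<And>z. z \<in> upper_half_plane \<Longrightarrow> (g has_field_derivative f z) (at z within upper_half_plane)"
    using holomorphic_convex_primitive'[OF convex_upper_half_plane open_upper_half_plane] by blast
  have "((\<lambda>z. v z - Re (g z)) has_derivative (\<lambda>h. 0)) (at z within upper_half_plane)" if z: "z \<in> upper_half_plane" for z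
  proof -
    have "(g has_derivative (*) (f z)) (at z within upper_half_plane)"
      using g[OF z] by (simp add: has_field_derivative_def)
    then have "((\<lambda>z. v z - Re (g z)) has_derivative (\<lambda>h. (Re h * p z + Im h * q z) - Re (f z * h))) (at z within upper_half_plane)"
      by (intro has_derivative_diff has_derivative_Re has_derivative_at_withinI[OF has_partials_on_has_derivative[OF v open_upper_half_plane z]])
    then show ?thesis by (simp add: f_def mult.commute)
  qed
  from has_derivative_zero_constant[OF convex_upper_half_plane this]
  obtain c where c: "\<And>z. z \<in> upper_half_plane \<Longrightarrow> v z - Re (g z) = c"
    by auto
  show thesis
  proof (rule that[of "\<lambda>z. g z + of_real c"])
    show "(\<lambda>z. g z + of_real c) holomorphic_on upper_half_plane"
      using g by (intro holomorphic_on_add holomorphic_on_const) (auto simp: holomorphic_on_def field_differentiable_def)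
    show "Re (g z + of_real c) = v z" if "z \<in> upper_half_plane" for z using c[OF that] by simp
  qed
qed

lemma Ck_on_Suc_has_partials:
  fixes u :: "complex \<Rightarrow> complex"
  assumes u: "Ck_on (Suc k) u S" and L: "bounded_linear L"
  shows "has_partials_on (\<lambda>z. L (u z)) (\<lambda>z. L (partial_deriv 1 u z)) (\<lambda>z. L (partial_deriv \<i> u z)) S"
proof -
  have B: "1 \<in> (Basis :: complex set)" "\<i> \<in> (Basis :: complex set)" by (auto simp: Basis_complex_def)
  have pc: "continuous_on S (partial_deriv v u)" if "v \<in> Basis" for v
    using u that by (cases k) auto
  have "((\<lambda>t. L (u (z + t *\<^sub>R v))) has_real_derivative L (partial_deriv v u z)) (at 0)"
    if "v \<in> Basis" "z \<in> S" for v z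
  proof -
    have "(\<lambda>t. u (z + t *\<^sub>R v)) differentiable (at (0::real))" using u that by auto
    then have "((\<lambda>t. u (z + t *\<^sub>R v)) has_vector_derivative partial_deriv v u z) (at 0)"
      unfolding partial_deriv_def by (simp add: vector_derivative_works)
    from bounded_linear.has_vector_derivative[OF L this]
    show ?thesis by (simp add: has_real_derivative_iff_has_vector_derivative)
  qed
  from this[OF B(1)] this[OF B(2)] show ?thesis
    unfolding has_partials_on_def
    by (auto intro!: bounded_linear.continuous_on[OF L] pc B simp: scaleR_conv_of_real)
qed

lemma harmonic_on_imp_Re_holomorphic:
  assumes u: "harmonic_on u upper_half_plane" and L: "bounded_linear L"
  obtains F where "F holomorphic_on upper_half_plane" "\<And>z. z \<in> upper_half_plane \<Longrightarrow> Re (F z) = L (u z)"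
proof -
  have C2: "Ck_on (Suc 1) u upper_half_plane" and lap: "\<And>z. z \<in> upper_half_plane \<Longrightarrow> laplacian u z = 0"
    using u by (auto simp: harmonic_on_def numeral_2_eq_2)
  have C1: "Ck_on (Suc 0) (partial_deriv v u) upper_half_plane" if "v \<in> Basis" for v
    using C2 that by simp
  have B: "1 \<in> (Basis :: complex set)" "\<i> \<in> (Basis :: complex set)" by (auto simp: Basis_complex_def)
  show thesis
  proof (rule harmonic_partials_imp_Re_holomorphic[OF Ck_on_Suc_has_partials[OF C2 L]
          Ck_on_Suc_has_partials[OF C1[OF B(1)] L] Ck_on_Suc_has_partials[OF C1[OF B(2)] L]])
    fix z assume "z \<in> upper_half_plane"
    then have "partial_deriv 1 (partial_deriv 1 u) z + partial_deriv \<i> (partial_deriv \<i> u) z = 0"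
      using lap by (simp add: laplacian_def Basis_complex_def)
    then have "L (partial_deriv 1 (partial_deriv 1 u) z + partial_deriv \<i> (partial_deriv \<i> u) z) = 0"
      using bounded_linear.linear[OF L] linear_0 by simp
    then show "L (partial_deriv 1 (partial_deriv 1 u) z) + L (partial_deriv \<i> (partial_deriv \<i> u) z) = 0"
      by (simp add: linear_add[OF bounded_linear.linear[OF L]])
  qed (use that in blast)
qed

section \<open>Polynomials\<close>

lemma higher_deriv_0_imp_poly:
  assumes F: "F holomorphic_on S" and S: "open S" "connected S" "a \<in> S"
    and d0: "\<And>z. z \<in> S \<Longrightarrow> (deriv ^^ n) F z = 0"
  obtains P where "\<And>z. z \<in> S \<Longrightarrow> F z = poly P z"
proof -
  have d0': "(deriv ^^ (k + n)) F z = 0" if "z \<in> S" for k z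
    using that
  proof (induction k arbitrary: z)
    case (Suc k)
    have "deriv ((deriv ^^ (k + n)) F) z = deriv (\<lambda>_. 0) z"
      by (rule complex_derivative_transform_within_open[OF holomorphic_higher_deriv[OF F S(1)] _ S(1) Suc.prems])
        (auto simp: Suc.IH)
    then show ?case by simp
  qed (simp add: d0)
  obtain r where r: "r > 0" "ball a r \<subseteq> S" using S open_contains_ball by blast
  define P where "P = (\<Sum>k<n. smult ((deriv ^^ k) F a / fact k) ([:- a, 1:] ^ k))"
  have eq: "F z = poly P z" if z: "z \<in> ball a r" for z
  proof -
    have "(\<lambda>k. (deriv ^^ k) F a / fact k * (z - a) ^ k) sums F z"
      by (rule holomorphic_power_series[OF holomorphic_on_subset[OF F r(2)] z])
    moreover have "(\<lambda>k. (deriv ^^ k) F a / fact k * (z - a) ^ k) sums (\<Sum>k<n. (deriv ^^ k) F a / fact k * (z - a) ^ k)"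
    proof (rule sums_finite)
      fix k assume "k \<notin> {..<n}"
      then have "(deriv ^^ k) F a = 0" using d0'[OF S(3), of "k - n"] by simp
      then show "(deriv ^^ k) F a / fact k * (z - a) ^ k = 0" by simp
    qed simp
    ultimately have "F z = (\<Sum>k<n. (deriv ^^ k) F a / fact k * (z - a) ^ k)" by (rule sums_unique2)
    then show ?thesis by (simp add: P_def poly_sum)
  qed
  have "F z = poly P z" if "z \<in> S" for z
    by (rule analytic_continuation_open[of "ball a r" S F "poly P"]) (use r S F eq that in \<open>auto intro!: holomorphic_intros\<close>)
  then show thesis by (rule that)
qed

text \<open>A nonzero coefficient at \<open>k \<ge> m\<close> forces
  \<open>m \<le> degree q\<close>. Dividing further by a power of \<open>t\<close> shows that
  \<open>q\<close> over its leading power tends to 0, although the limit is the leading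
  coefficient.\<close>

lemma poly_tendsto_0_imp_coeff_0:
  fixes q :: "real poly"
  assumes lim: "((\<lambda>t. poly q t / t ^ m) \<longlongrightarrow> 0) at_top" and k: "m \<le> k"
  shows "coeff q k = 0"
proof (rule ccontr)
  assume nz: "coeff q k \<noteq> 0"
  then have deg: "m \<le> degree q" using k le_degree le_trans by blast
  have "((\<lambda>t::real. inverse t ^ (degree q - m)) \<longlongrightarrow> (if degree q = m then 1 else 0)) at_top"
  proof (cases "degree q = m")
    case False
    then have "((\<lambda>t::real. inverse t ^ (degree q - m)) \<longlongrightarrow> 0) at_top"
      using deg by (intro tendsto_null_power tendsto_inverse_0_at_top filterlim_ident) auto
    then show ?thesis using False by simp
  qed simp
  from tendsto_mult[OF lim this]
  have "((\<lambda>t. poly q t / t ^ m * inverse t ^ (degree q - m)) \<longlongrightarrow> 0) at_top" by simp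
  moreover have "\<forall>\<^sub>F t in at_top. poly q t / t ^ m * inverse t ^ (degree q - m) = poly q t / t ^ degree q"
    using eventually_gt_at_top[of 0]
  proof eventually_elim
    case (elim t)
    have "t ^ degree q = t ^ m * t ^ (degree q - m)" using deg by (simp flip: power_add)
    then show ?case by (simp add: power_inverse divide_inverse)
  qed
  ultimately have "((\<lambda>t. poly q t / t ^ degree q) \<longlongrightarrow> 0) at_top"
    by (rule Lim_transform_eventually)
  moreover have "((\<lambda>t. poly q t / t ^ degree q) \<longlongrightarrow> lead_coeff q) at_top"
    using poly_divide_tendsto_aux[of q] at_top_le_at_infinity by (rule tendsto_mono[rotated])
  ultimately have "lead_coeff q = 0" using tendsto_unique trivial_limit_at_top_linorder by blast
  then show False using nz by simp
qed

section \<open>Pointwise information from all mollifications\<close>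

text \<open>If \<open>k 0 > 0\<close>, a bump concentrated where \<open>k\<close> is nonnegative
  makes the integrand nonnegative, continuous and positive at 0, yet of integral 0. The one-sided
  form serves squared norms directly, and equalities through \<open>k\<close> and
  \<open>- k\<close>.\<close>

lemma smooth_bump_test_zero:
  fixes k :: "real \<Rightarrow> real"
  assumes k: "continuous_on {-1..1} k"
    and int: "\<And>D. smooth_bump D \<Longrightarrow> ((\<lambda>s. k s * D 0 s) has_integral 0) {-1..1}"
  shows "k 0 \<le> 0"
proof (rule ccontr)
  assume "\<not> k 0 \<le> 0"
  then have k0: "k 0 > 0" by simp
  have "\<exists>d>0. \<forall>s\<in>{-1..1}. dist s 0 < d \<longrightarrow> dist (k s) (k 0) < k 0"
    using k k0 unfolding continuous_on_iff by force
  then obtain d where d: "d > 0" "\<And>s. s \<in> {-1..1} \<Longrightarrow> \<bar>s\<bar> < d \<Longrightarrow> \<bar>k s - k 0\<bar> < k 0"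
    by (auto simp: dist_real_def)
  have "0 < min d 1" "min d 1 \<le> 1" using d by auto
  then obtain D where D: "smooth_bump D" "\<And>x. D 0 x \<ge> 0" "D 0 0 > 0" "\<And>x. min d 1 \<le> \<bar>x\<bar> \<Longrightarrow> D 0 x = 0"
    using smooth_bump_concentrated by blast
  have "k 0 * D 0 0 = 0"
  proof (rule has_integral_0_cbox_imp_0[where f = "\<lambda>s. k s * D 0 s" and a = "-1" and b = 1])
    show "continuous_on (cbox (-1) 1) (\<lambda>s. k s * D 0 s)"
      using k smooth_bump_continuous[OF D(1)] by (auto intro!: continuous_intros)
    show "0 \<le> k s * D 0 s" if "s \<in> box (-1) 1" for s
    proof (cases "\<bar>s\<bar> < d")
      case True
      then have "k s \<ge> 0" using d(2)[of s] that by force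
      then show ?thesis using D(2) by simp
    qed (simp add: D(4) min_le_iff_disj)
  qed (use int[OF D(1)] in auto)
  then show False using k0 D(3) by simp
qed

text \<open>The real function tested is \<open>Re (g (z - of_real s) * cnj (g z))\<close>, whose
  value at \<open>s = 0\<close> is \<open>(norm (g z))\<^sup>2\<close>.\<close>

lemma hconv_eq_0_imp_eq_0:
  assumes g: "continuous_on upper_half_plane g" and z: "z \<in> upper_half_plane"
    and 0: "\<And>D. smooth_bump D \<Longrightarrow> hconv g (D 0) z = 0"
  shows "g z = 0"
proof -
  let ?k = "\<lambda>s. Re (g (z - of_real s) * cnj (g z))"
  have "?k 0 \<le> 0"
  proof (rule smooth_bump_test_zero)
    have cg: "continuous_on {-1..1} (\<lambda>s. g (z - of_real s))"
      by (rule continuous_on_compose2[OF g]) (use z in \<open>auto intro!: continuous_intros\<close>)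
    then show "continuous_on {-1..1} ?k" by (intro continuous_intros)
    fix D assume D: "smooth_bump D"
    have "((\<lambda>s. g (z - of_real s) * of_real (D 0 s)) has_integral hconv g (D 0) z) {-1..1}"
      unfolding hconv_def
      by (intro integrable_integral integrable_continuous_real
          hconv_integrand_continuous g z smooth_bump_continuous[OF D])
    then have "((\<lambda>s. g (z - of_real s) * of_real (D 0 s) * cnj (g z)) has_integral 0) {-1..1}"
      using has_integral_mult_left[of _ "hconv g (D 0) z" _ "cnj (g z)"] 0[OF D] by auto
    from has_integral_linear[OF this bounded_linear_Re]
    show "((\<lambda>s. ?k s * D 0 s) has_integral 0) {-1..1}"
      by (simp add: o_def algebra_simps)
  qed
  then have "Re (of_real ((norm (g z))\<^sup>2)) \<le> 0" unfolding complex_norm_square by simp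
  then show ?thesis by simp
qed

lemma temperate_zero_boundary_higher_deriv_0:
  fixes N :: nat
  assumes F: "F holomorphic_on upper_half_plane" and bv: "zero_boundary_Re F"
    and C: "0 < C" and R: "1 \<le> R"
    and bd: "\<And>z. z \<in> upper_half_plane \<Longrightarrow> R < norm z \<Longrightarrow> \<bar>Re (F z)\<bar> \<le> C * ((norm z)\<^sup>2 / Im z) ^ N"
    and z: "z \<in> upper_half_plane"
  shows "(deriv ^^ (3 * N + 3)) F z = 0"
proof (rule hconv_eq_0_imp_eq_0[OF _ z])
  let ?n = "3 * N + 3"
  show "continuous_on upper_half_plane ((deriv ^^ ?n) F)"
    by (intro holomorphic_on_imp_continuous_on holomorphic_higher_deriv F open_upper_half_plane)
  fix D assume D: "smooth_bump D"
  note Dc = smooth_bump_continuous[OF D]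
  have G: "hconv F (D 0) holomorphic_on upper_half_plane" by (rule hconv_holomorphic[OF F Dc])
  obtain h where h: "h holomorphic_on UNIV" "\<And>z. z \<in> upper_half_plane \<Longrightarrow> h z = \<i> * hconv F (D 0) z"
    "\<And>z. h (cnj z) = cnj (h z)"
    using entire_reflection[OF G hconv_bump_lipschitz[OF F bv D] Re_hconv_tendsto_0[OF F bv D]] by blast
  obtain B where B: "B > 0" "\<And>x. \<bar>D 0 x\<bar> \<le> B" using smooth_bump_bounded[OF D] by blast
  \<comment> \<open>\<open>2 * B\<close> bounds the mass of the kernel on [-1, 1], and
    \<open>4 ^ N\<close> comes from \<open>norm (w - of_real s) \<le> 2 * norm w\<close>. The radius
    \<open>R + 1\<close> below keeps the shifted points outside radius \<open>R\<close>.\<close>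
  let ?C = "2 * B * C * 4 ^ N"
  have up: "\<bar>Im (h w)\<bar> \<le> ?C * ((norm w)\<^sup>2 / Im w) ^ N" if w: "R + 1 < norm w" "0 < Im w" for w
  proof -
    have wH: "w \<in> upper_half_plane" using w by (simp add: upper_half_plane_def)
    have "\<bar>Re (hconv F (D 0) w)\<bar> \<le> 2 * B * (C * (4 * (norm w)\<^sup>2 / Im w) ^ N)"
    proof (rule Re_hconv_le[OF holomorphic_on_imp_continuous_on[OF F] Dc wH B(2)])
      fix s :: real assume s: "\<bar>s\<bar> \<le> 1"
      have n1: "R < norm (w - of_real s)" using norm_triangle_ineq2[of w "of_real s"] s w by simp
      have "norm (w - of_real s) \<le> 2 * norm w" using norm_triangle_ineq4[of w "of_real s"] s w R by simp
      then have "(norm (w - of_real s))\<^sup>2 \<le> (2 * norm w)\<^sup>2" by (intro power_mono) auto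
      then have n2: "(norm (w - of_real s))\<^sup>2 \<le> 4 * (norm w)\<^sup>2" by (simp add: power_mult_distrib)
      have "\<bar>Re (F (w - of_real s))\<bar> \<le> C * ((norm (w - of_real s))\<^sup>2 / Im (w - of_real s)) ^ N"
        using wH n1 by (intro bd) auto
      also have "\<dots> \<le> C * (4 * (norm w)\<^sup>2 / Im w) ^ N"
        using C w n2 by (intro mult_left_mono power_mono) (auto simp: divide_right_mono)
      finally show "\<bar>Re (F (w - of_real s))\<bar> \<le> C * (4 * (norm w)\<^sup>2 / Im w) ^ N" .
    qed
    also have "\<dots> = ?C * ((norm w)\<^sup>2 / Im w) ^ N"
      by (simp add: power_mult_distrib power_divide)
    finally show ?thesis by (simp add: h(2)[OF wH])
  qed
  have "\<bar>Im (h w)\<bar> \<le> ?C * ((norm w)\<^sup>2 / \<bar>Im w\<bar>) ^ N" if w: "R + 1 < norm w" "Im w \<noteq> 0" for w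
  proof (cases "0 < Im w")
    case False
    then have "\<bar>Im (h (cnj w))\<bar> \<le> ?C * ((norm (cnj w))\<^sup>2 / Im (cnj w)) ^ N" using w by (intro up) auto
    then show ?thesis using False by (simp add: h(3))
  qed (use up[of w] w in simp)
  then have "(deriv ^^ ?n) h z = 0"
    using B C R h(1) by (intro entire_temperate_Im_imp_higher_deriv_0[of h ?C "R + 1"]) auto
  moreover have "(deriv ^^ ?n) h z = (deriv ^^ ?n) (\<lambda>w. \<i> * hconv F (D 0) w) z"
    by (rule higher_deriv_transform_within_open[OF holomorphic_on_subset[OF h(1)] _ open_upper_half_plane z h(2)])
      (auto intro!: holomorphic_intros G)
  moreover have "\<dots> = \<i> * (deriv ^^ ?n) (hconv F (D 0)) z"
    by (rule higher_deriv_cmult[OF G z open_upper_half_plane])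
  ultimately show "hconv ((deriv ^^ ?n) F) (D 0) z = 0"
    using hconv_higher_deriv[OF F Dc z, of ?n] by simp
qed

text \<open>For a polynomial the mollification is continuous down to \<open>y = 0\<close>, so its
  limit 0 is also the convolution on the real axis. As this holds for every bump, testing both signs
  gives the pointwise statement.\<close>

lemma zero_boundary_poly_Re_0:
  assumes F: "F holomorphic_on upper_half_plane" and bv: "zero_boundary_Re F"
    and P: "\<And>z. z \<in> upper_half_plane \<Longrightarrow> F z = poly P z"
  shows "Re (poly P (of_real x)) = 0"
proof -
  let ?k = "\<lambda>s. Re (poly P (Complex (x - s) 0))"
  have int0: "((\<lambda>s. ?k s * D 0 s) has_integral 0) {-1..1}" if D: "smooth_bump D" for D
  proof -
    let ?Q = "\<lambda>y. integral (cbox (-1) 1) (\<lambda>s. Re (poly P (Complex (x - s) y)) * D 0 s)"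
    have Dsnd: "continuous_on S (\<lambda>w. D 0 (snd w))" for S :: "(real \<times> real) set"
      by (rule continuous_on_compose2[OF smooth_bump_continuous[OF D, of UNIV]]) (auto intro!: continuous_intros)
    have "continuous_on (UNIV \<times> cbox (-1) 1) (\<lambda>(y, s). Re (poly P (Complex (x - s) y)) * D 0 s)"
      unfolding split_beta Complex_eq by (intro continuous_intros Dsnd)
    then have "continuous_on UNIV ?Q"
      by (rule integral_continuous_on_param)
    then have "(?Q \<longlongrightarrow> ?Q 0) (at_right 0)"
      by (auto simp: continuous_on_def intro: tendsto_mono[OF at_le])
    moreover have "\<forall>\<^sub>F y in at_right 0. Re (hconv F (D 0) (Complex x y)) = ?Q y"
      unfolding eventually_at_filter
    proof (intro always_eventually allI impI)
      fix y :: real assume "y \<noteq> 0" "y \<in> {0<..}"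
      then have y: "Complex x y \<in> upper_half_plane" by (simp add: upper_half_plane_def)
      have e: "Complex x y - of_real s = Complex (x - s) y" for s by (simp add: complex_eq_iff)
      have e': "F (Complex (x - s) y) = poly P (Complex (x - s) y)" for s
        using P[of "Complex (x - s) y"] y by (simp add: upper_half_plane_def)
      have "((\<lambda>s. Re (F (Complex x y - of_real s)) * D 0 s) has_integral Re (hconv F (D 0) (Complex x y))) {-1..1}"
        by (rule Re_hconv[OF holomorphic_on_imp_continuous_on[OF F] smooth_bump_continuous[OF D] y])
      then show "Re (hconv F (D 0) (Complex x y)) = ?Q y"
        unfolding e e' by (simp add: integral_unique)
    qed
    then have "(?Q \<longlongrightarrow> 0) (at_right 0)"
      using Re_hconv_tendsto_0[OF F bv D, of x] by (rule Lim_transform_eventually[rotated])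
    ultimately have Q0: "?Q 0 = 0" by (intro tendsto_unique[of "at_right (0::real)"]) auto
    have "(\<lambda>s. ?k s * D 0 s) integrable_on {-1..1}"
      unfolding Complex_eq
      by (intro integrable_continuous_real continuous_intros smooth_bump_continuous[OF D])
    then show ?thesis using Q0 by (simp add: has_integral_integrable_integral)
  qed
  have cont: "continuous_on {-1..1} ?k" unfolding Complex_eq by (intro continuous_intros)
  have "?k 0 \<le> 0" using cont int0 by (rule smooth_bump_test_zero)
  moreover have "- ?k 0 \<le> 0"
  proof (rule smooth_bump_test_zero[where k = "\<lambda>s. - ?k s"])
    show "continuous_on {-1..1} (\<lambda>s. - ?k s)" using cont by (rule continuous_on_minus)
    show "((\<lambda>s. - ?k s * D 0 s) has_integral 0) {-1..1}" if "smooth_bump D" for D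
      using has_integral_neg[OF int0[OF that]] by simp
  qed
  ultimately show ?thesis by (simp add: complex_of_real_def)
qed

section \<open>Polynomials on rays and the admissible angles\<close>

lemma poly_cis:
  "poly P (of_real t * cis \<theta>) = (\<Sum>k\<le>degree P. coeff P k * of_real (t ^ k) * cis (real k * \<theta>))"
  unfolding poly_altdef power_mult_distrib Complex.DeMoivre by (simp add: mult.assoc)

lemma Re_holomorphic_eq_0:
  assumes F: "F holomorphic_on upper_half_plane" and bv: "zero_boundary_Re F"
    and temp: "\<exists>C>0. \<exists>R>0. \<exists>N>0. \<forall>z\<in>upper_half_plane. norm z > R \<longrightarrow>
       \<bar>Re (F z)\<bar> \<le> C * ((norm z)\<^sup>2 / Im z) powr N"
    and adm: "admissible_angles E \<eta>"
    and ray: "\<And>\<theta>. \<theta> \<in> E \<Longrightarrow> ((\<lambda>t. Re (F (of_real t * cis \<theta>)) / t ^ \<eta> \<theta>) \<longlongrightarrow> 0) at_top"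
    and z: "z \<in> upper_half_plane"
  shows "Re (F z) = 0"
proof -
  obtain C R N where CRN: "C > 0" "R > 0" "N > 0" and bd0: "\<And>z. z \<in> upper_half_plane \<Longrightarrow> R < norm z \<Longrightarrow>
       \<bar>Re (F z)\<bar> \<le> C * ((norm z)\<^sup>2 / Im z) powr N"
    using temp by blast
  \<comment> \<open>The degree bound counts derivatives, so the exponent is rounded up. This
    enlarges the bound where the quotient is at least 1, which \<open>norm w > 1\<close> ensures:
    \<open>Im w \<le> norm w \<le> (norm w)\<^sup>2\<close>.\<close>
  define M where "M = nat \<lceil>N\<rceil>"
  have bd: "\<bar>Re (F w)\<bar> \<le> C * ((norm w)\<^sup>2 / Im w) ^ M" if w: "w \<in> upper_half_plane" "max R 1 < norm w" for w
  proof -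
    have Im: "0 < Im w" using w by (simp add: upper_half_plane_def)
    have "Im w \<le> norm w" using abs_Im_le_cmod[of w] by simp
    also have "\<dots> \<le> (norm w)\<^sup>2" using w mult_left_mono[of 1 "norm w" "norm w"] by (simp add: power2_eq_square)
    finally have 1: "1 \<le> (norm w)\<^sup>2 / Im w" using Im by simp
    have "((norm w)\<^sup>2 / Im w) powr N \<le> ((norm w)\<^sup>2 / Im w) powr (real M)"
      using 1 by (intro powr_mono) (auto simp: M_def real_nat_ceiling_ge)
    also have "\<dots> = ((norm w)\<^sup>2 / Im w) ^ M" using 1 by (intro powr_realpow) auto
    finally show ?thesis using bd0[of w] w CRN by (meson max_less_iff_conj mult_left_mono order_trans less_imp_le)
  qed
  have "(deriv ^^ (3 * M + 3)) F w = 0" if "w \<in> upper_half_plane" for w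
    using CRN by (intro temperate_zero_boundary_higher_deriv_0[OF F bv, where C = C and R = "max R 1"] bd that) auto
  then obtain P where P: "\<And>z. z \<in> upper_half_plane \<Longrightarrow> F z = poly P z"
    using higher_deriv_0_imp_poly[OF F open_upper_half_plane convex_connected[OF convex_upper_half_plane] z] by blast
  \<comment> \<open>On the real axis \<open>Re (poly P x)\<close> is the real polynomial with
    coefficients \<open>Re (coeff P k)\<close>, and it vanishes identically.\<close>
  have "map_poly Re P = 0"
  proof -
    have "poly (map_poly Re P) x = Re (poly P (of_real x))" for x
    proof -
      have "degree (map_poly Re P) \<le> degree P" by (rule degree_le) (simp add: coeff_map_poly coeff_eq_0)
      then have "poly (map_poly Re P) x = (\<Sum>k\<le>degree P. coeff (map_poly Re P) k * x ^ k)"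
        unfolding poly_altdef by (intro sum.mono_neutral_left) (auto simp: coeff_eq_0)
      then show ?thesis by (simp add: poly_altdef coeff_map_poly flip: of_real_power)
    qed
    then have "poly (map_poly Re P) = (\<lambda>x. 0)"
      using zero_boundary_poly_Re_0[OF F bv P] by auto
    then show ?thesis using poly_all_0_iff_0 by metis
  qed
  then have Re0: "Re (coeff P k) = 0" for k
    by (metis coeff_0 coeff_map_poly zero_complex.sel(1))
  have "coeff P k = 0" if k: "k \<ge> 1" for k
  proof -
    obtain \<theta> where \<theta>: "\<theta> \<in> E" "sin (real k * \<theta>) \<noteq> 0" "\<eta> \<theta> \<le> k" "0 < \<theta>" "\<theta> < pi"
      using adm k unfolding admissible_angles_def by (metis greaterThanLessThan_iff subsetD)
    define q where "q = (\<Sum>j\<le>degree P. monom (- Im (coeff P j) * sin (real j * \<theta>)) j)"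
    have q: "poly q t = Re (F (of_real t * cis \<theta>))" if "t > 0" for t
    proof -
      have "of_real t * cis \<theta> \<in> upper_half_plane"
        using that sin_gt_zero[OF \<theta>(4,5)] by (simp add: upper_half_plane_def)
      then show ?thesis
        unfolding P[OF \<open>of_real t * cis \<theta> \<in> upper_half_plane\<close>] poly_cis
        by (simp add: q_def poly_sum poly_monom Re0 mult_ac del: of_real_power)
    qed
    have "((\<lambda>t. poly q t / t ^ \<eta> \<theta>) \<longlongrightarrow> 0) at_top"
    proof (rule Lim_transform_eventually[OF ray[OF \<theta>(1)]])
      show "\<forall>\<^sub>F t in at_top. Re (F (of_real t * cis \<theta>)) / t ^ \<eta> \<theta> = poly q t / t ^ \<eta> \<theta>"
        using eventually_gt_at_top[of 0] by eventually_elim (simp add: q)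
    qed
    then have "coeff q k = 0" using \<theta>(3) by (rule poly_tendsto_0_imp_coeff_0)
    moreover have "coeff q k = - Im (coeff P k) * sin (real k * \<theta>)"
      by (cases "k \<le> degree P") (auto simp: q_def coeff_sum coeff_eq_0)
    ultimately show ?thesis using \<theta>(2) Re0[of k] by (simp add: complex_eq_iff)
  qed
  then have "poly P z = coeff P 0"
    by (simp add: poly_altdef sum.atMost_shift)
  then show ?thesis using P[OF z] Re0[of 0] by simp
qed

section \<open>Real and imaginary parts of a complex harmonic function\<close>

text \<open>\<open>L\<close> passes through the product because \<open>\<psi>\<close> is real, and
  through the integral because the integrand is continuous with compact support, hence
  integrable.\<close>

lemma zero_boundary_Re_bounded_linear:
  assumes u: "continuous_on upper_half_plane u" and bv: "distributional_boundary_value_zero u"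
    and L: "L = Re \<or> L = Im" and F: "\<And>z. z \<in> upper_half_plane \<Longrightarrow> Re (F z) = L (u z)"
  shows "zero_boundary_Re F"
  unfolding zero_boundary_Re_def
proof (intro allI impI)
  fix \<psi> :: "real \<Rightarrow> real" assume t: "test_function (\<lambda>x. of_real (\<psi> x))"
  let ?I = "\<lambda>y. \<integral>x. u (Complex x y) * of_real (\<psi> x) \<partial>lborel"
  have "(?I \<longlongrightarrow> 0) (at_right 0)"
    using bv t by (simp add: distributional_boundary_value_zero_def)
  then have "((\<lambda>y. L (?I y)) \<longlongrightarrow> 0) (at_right 0)"
    using L by (auto dest: tendsto_Re tendsto_Im)
  moreover have "\<forall>\<^sub>F y in at_right 0. L (?I y) = (\<integral>x. Re (F (Complex x y)) * \<psi> x \<partial>lborel)"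
    unfolding eventually_at_filter
  proof (intro always_eventually allI impI)
    fix y :: real assume "y \<noteq> 0" "y \<in> {0<..}"
    then have H: "Complex x y \<in> upper_half_plane" for x by (simp add: upper_half_plane_def)
    let ?K = "closure {x. complex_of_real (\<psi> x) \<noteq> 0}" and ?f = "\<lambda>x. u (Complex x y) * complex_of_real (\<psi> x)"
    have "compact ?K" using t by (simp add: test_function_def)
    moreover have "continuous_on UNIV (\<lambda>x. complex_of_real (\<psi> x))"
      using t by (metis Ck_on.simps(1) test_function_def)
    moreover have "continuous_on UNIV (\<lambda>x. u (Complex x y))"
      by (rule continuous_on_compose2[OF u]) (use H in \<open>auto simp: Complex_eq intro!: continuous_intros\<close>)
    ultimately have "integrable lborel (\<lambda>x. indicator ?K x *\<^sub>R ?f x)"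
      by (intro borel_integrable_compact continuous_on_mult) (auto intro: continuous_on_subset)
    moreover have "(\<lambda>x. indicator ?K x *\<^sub>R ?f x) = ?f"
    proof
      show "indicator ?K x *\<^sub>R ?f x = ?f x" for x
        using closure_subset[of "{x. complex_of_real (\<psi> x) \<noteq> 0}"] by (cases "\<psi> x = 0") auto
    qed
    ultimately have int: "integrable lborel ?f" by simp
    show "L (?I y) = (\<integral>x. Re (F (Complex x y)) * \<psi> x \<partial>lborel)"
      using L integral_Re[OF int] integral_Im[OF int] F[OF H] by auto
  qed
  ultimately show "((\<lambda>y. \<integral>x. Re (F (Complex x y)) * \<psi> x \<partial>lborel) \<longlongrightarrow> 0) (at_right 0)"
    by (rule Lim_transform_eventually)
qed

theorem theorem8p4:
  fixes u :: "complex \<Rightarrow> complex"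
  assumes "harmonic_on u upper_half_plane"
    and "temperate_at_infinity u"
    and "distributional_boundary_value_zero u"
    and "\<exists>E \<eta>. admissible_angles E \<eta> \<and>
           (\<forall>\<theta>\<in>E. ((\<lambda>t::real. u (of_real t * cis \<theta>) / of_real t ^ \<eta> \<theta>) \<longlongrightarrow> 0) at_top)"
  shows "\<forall>z\<in>upper_half_plane. u z = 0"
proof
  fix z assume z: "z \<in> upper_half_plane"
  obtain E \<eta> where adm: "admissible_angles E \<eta>"
    and ray: "\<And>\<theta>. \<theta> \<in> E \<Longrightarrow> ((\<lambda>t::real. u (of_real t * cis \<theta>) / of_real t ^ \<eta> \<theta>) \<longlongrightarrow> 0) at_top"
    using assms(4) by blast
  have u: "continuous_on upper_half_plane u"
    using assms(1) by (simp add: harmonic_on_def numeral_2_eq_2)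
  have "L (u z) = 0" if L: "L = Re \<or> L = Im" for L
  proof -
    have bl: "bounded_linear L" using L bounded_linear_Re bounded_linear_Im by auto
    obtain F where F: "F holomorphic_on upper_half_plane" "\<And>z. z \<in> upper_half_plane \<Longrightarrow> Re (F z) = L (u z)"
      using harmonic_on_imp_Re_holomorphic[OF assms(1) bl] by blast
    have le: "\<bar>L w\<bar> \<le> norm w" for w using L abs_Re_le_cmod abs_Im_le_cmod by auto
    have "Re (F z) = 0"
    proof (rule Re_holomorphic_eq_0[OF F(1) _ _ adm _ z])
      show "zero_boundary_Re F"
        by (rule zero_boundary_Re_bounded_linear[OF u assms(3) L F(2)])
      show "\<exists>C>0. \<exists>R>0. \<exists>N>0. \<forall>z\<in>upper_half_plane. R < norm z \<longrightarrow>
          \<bar>Re (F z)\<bar> \<le> C * ((norm z)\<^sup>2 / Im z) powr N"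
        using assms(2) unfolding temperate_at_infinity_def by (metis F(2) le order_trans)
      fix \<theta> assume \<theta>: "\<theta> \<in> E"
      have "((\<lambda>t. L (u (of_real t * cis \<theta>) / of_real t ^ \<eta> \<theta>)) \<longlongrightarrow> 0) at_top"
        using L tendsto_Re[OF ray[OF \<theta>]] tendsto_Im[OF ray[OF \<theta>]] by auto
      \<comment> \<open>Restricted to \<open>t > 0\<close>, where the ray lies in the half-plane and
        \<open>Re F\<close> agrees with \<open>L u\<close>.\<close>
      moreover have "\<forall>\<^sub>F t in at_top. L (u (of_real t * cis \<theta>) / of_real t ^ \<eta> \<theta>) =
          Re (F (of_real t * cis \<theta>)) / t ^ \<eta> \<theta>"
        using eventually_gt_at_top[of 0]
      proof eventually_elim
        case (elim t)
        have "0 < \<theta>" "\<theta> < pi" using adm \<theta> by (auto simp: admissible_angles_def)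
        then have "of_real t * cis \<theta> \<in> upper_half_plane"
          using elim sin_gt_zero by (simp add: upper_half_plane_def)
        moreover have "L (w / of_real t ^ \<eta> \<theta>) = L w / t ^ \<eta> \<theta>" for w
          using L by (auto simp flip: of_real_power)
        ultimately show ?case by (simp add: F(2))
      qed
      ultimately show "((\<lambda>t. Re (F (of_real t * cis \<theta>)) / t ^ \<eta> \<theta>) \<longlongrightarrow> 0) at_top"
        by (rule Lim_transform_eventually)
    qed
    then show ?thesis using F(2)[OF z] by simp
  qed
  from this[of Re] this[of Im] show "u z = 0" by (simp add: complex_eq_iff)
qed

end
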